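(* Let $n\ge2$ and let $\Omega$ be a bounded $s$-John domain in $\mathbb{R}^n$ with $1\le s<n/(n-1)$. Let $\delta\in(0,n]$, $p\in(\delta/n,\ \delta/(n+s(1-n)))$ and $\kappa\in[0,\ n+s(1-n))$, and put $q=\frac{(\delta-\kappa p)p}{\delta-p(n+s(1-n))}$. Then there is a constant $c$ depending only on $n,\delta,\kappa,p,\Omega$ such that \[ \inf_{b\in\mathbb{R}}\Big(\int_\Omega|u(x)-b|^q\,d\mathcal{H}^{\delta-\kappa p}_\infty\Big)^{1/q}\le c\Big(\int_\Omega|\nabla u(x)|^p\,d\mathcal{H}^{\delta}_\infty\Big)^{1/p} \] for all $u\in C^1(\Omega)$.
   Context: Let $s\ge1$. A bounded domain (open connected set) $\Omega\subset\mathbb{R}^n$ is an $s$-John domain if there are finite positive constants $c_J,C_J$ and a point $x_0\in\Omega$ such that every $x\in\Omega$ can be joined to $x_0$ by a rectifiable curve $\gamma_x:[0,\ell(\gamma_x)]\to\Omega$ parametrised by arc length with $\gamma_x(0)=x$, $\gamma_x(\ell(\gamma_x))=x_0$, $\ell(\gamma_x)\le C_J$, and $\operatorname{dist}(\gamma_x(t),\partial\Omega)\ge c_J t^s$ for all $t\in[0,\ell(\gamma_x)]$. For $E\subset\mathbb{R}^n$ and $\beta\in(0,n]$, $\mathcal{H}^{\beta}_\infty(E)=\inf\{\sum_i r_i^{\beta}: E\subset\bigcup_i B(x_i,r_i)\}$ over countable or finite coverings by open balls. For $f:\Omega\to[0,\infty]$, $\int_\Omega f\,d\mathcal{H}^{\beta}_\infty:=\int_0^\infty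 \mathcal{H}^{\beta}_\infty(\{x\in\Omega: f(x)>t\})\,dt$. *)

theory Defs
  imports "HOL-Analysis.Analysis"
begin

definition curve_length :: "(real \<Rightarrow> 'a::metric_space) \<Rightarrow> real \<Rightarrow> real \<Rightarrow> ennreal" where
  "curve_length \<gamma> a b =
     (SUP tk \<in> {(t, k). t 0 = a \<and> t k = b \<and> (\<forall>i<k. t i \<le> t (Suc i))}.
        ennreal (\<Sum>i<snd tk. dist (\<gamma> (fst tk (Suc i))) (\<gamma> (fst tk i))))"

definition arclength_param :: "(real \<Rightarrow> 'a::metric_space) \<Rightarrow> real \<Rightarrow> bool" where
  "arclength_param \<gamma> l \<longleftrightarrow> 0 \<le> l \<and>
     (\<forall>t1 t2. 0 \<le> t1 \<and> t1 \<le> t2 \<and> t2 \<le> l \<longrightarrow> curve_length \<gamma> t1 t2 = ennreal (t2 - t1))"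

definition s_john_domain :: "real \<Rightarrow> 'a::euclidean_space set \<Rightarrow> bool" where
  "s_john_domain s \<Omega> \<longleftrightarrow> 1 \<le> s \<and> open \<Omega> \<and> connected \<Omega> \<and> bounded \<Omega> \<and>
     (\<exists>cJ CJ x0. 0 < cJ \<and> 0 < CJ \<and> x0 \<in> \<Omega> \<and>
        (\<forall>x\<in>\<Omega>. \<exists>\<gamma> l. arclength_param \<gamma> l \<and> \<gamma> 0 = x \<and> \<gamma> l = x0 \<and> l \<le> CJ \<and>
           (\<forall>t\<in>{0..l}. \<gamma> t \<in> \<Omega> \<and> infdist (\<gamma> t) (frontier \<Omega>) \<ge> cJ * t powr s)))"

text \<open>Hausdorff content H^\<beta>_\<infinity>: infimum over countable (or finite: pad with radius 0,
  i.e. empty balls) coverings by open balls.\<close>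
definition hausdorff_content :: "real \<Rightarrow> 'a::metric_space set \<Rightarrow> ennreal" where
  "hausdorff_content \<beta> E =
     (INF xr \<in> {(x, r). (\<forall>i. 0 \<le> r i) \<and> E \<subseteq> (\<Union>i. ball (x i) (r i))}.
        (\<Sum>i. ennreal (snd xr i powr \<beta>)))"

definition choquet_integral :: "real \<Rightarrow> 'a::metric_space set \<Rightarrow> ('a \<Rightarrow> real) \<Rightarrow> ennreal" where
  "choquet_integral \<beta> \<Omega> f =
     (\<integral>\<^sup>+ t. indicator {0<..} t * hausdorff_content \<beta> {x\<in>\<Omega>. f x > t} \<partial>lborel)"

text \<open>Real power of an extended nonnegative real (exponent a > 0), with \<infinity>^a = \<infinity>.\<close>
definition enn_powr :: "ennreal \<Rightarrow> real \<Rightarrow> ennreal" where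
  "enn_powr x a = (if x = \<infinity> then \<infinity> else ennreal (enn2real x powr a))"

end

theory Submission
  imports Defs
begin

text \<open>
  Put \<open>a = n + s (1 - n)\<close> and \<open>f = |\<nabla>u|\<close>. Averaging \<open>u\<close> over cubes centred on the John curve of \<open>x\<close>, and
  replacing the curve in each dyadic scale by a chain that cannot be shortened, bounds \<open>|u x - b|\<close> by the
  dyadic Riesz potential \<open>\<Sum>\<^sub>j r\<^sub>j powr (a - n) * \<integral>\<^bsub>B(x, r\<^sub>j)\<^esub> f\<close> with \<open>r\<^sub>j = R / 2^j\<close>.

  Choose coverings of the sets \<open>{f > 2^k}\<close> by balls that almost realise their \<open>\<delta>\<close>-contents. At level \<open>m\<close>
  call a ball dense if for some \<open>k \<ge> m\<close> the \<open>k\<close>-th covering has \<open>\<delta>\<close>-density at least \<open>2 powr ((m - k) p0)\<close>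
  in it, where \<open>\<delta>/n < p0 < p\<close>, and select dense balls by Vitali's lemma. A ball that is not captured by the
  selected ones has \<open>f\<close>-average at most a constant times \<open>2^m\<close>, because \<open>p0 n / \<delta> > 1\<close>; and the selected
  balls, with radii \<open>t\<close>, satisfy \<open>\<Sum> 2 powr (m p) * t powr \<delta> \<le> C \<integral> f powr p\<close>, because
  \<open>p0 < p\<close>. These balls, with heights \<open>h\<close> proportional to \<open>2^m\<close>, play the role of a strong type estimate for
  all fractional maximal functions at once.

  Splitting the sum over \<open>j\<close> as in Hedberg's inequality, \<open>|u x - b| powr q > t\<close> forces \<open>x\<close> into one of the
  balls with \<open>M (h r powr \<kappa>) powr p > t\<close>, and integrating the resulting covers over \<open>t\<close> gives the claim.
\<close>

subsection \<open>Cube means\<close>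

abbreviation ball_integral :: "('a::euclidean_space \<Rightarrow> real) \<Rightarrow> 'a \<Rightarrow> real \<Rightarrow> ennreal" where
  "ball_integral f x r \<equiv> \<integral>\<^sup>+y\<in>ball x r. ennreal (f y) \<partial>lborel"

definition cube_mean :: "('a::euclidean_space \<Rightarrow> real) \<Rightarrow> 'a \<Rightarrow> real \<Rightarrow> real" where
  "cube_mean u w r = integral (cbox (-One) One) (\<lambda>z. u (w + r *\<^sub>R z)) / 2 ^ DIM('a)"

lemma content_centered_cube: "measure lborel (cbox (-One) (One :: 'a::euclidean_space)) = 2 ^ DIM('a)"
  by (subst content_cbox) (auto simp: inner_diff_left)

lemma norm_le_DIM_of_mem_centered_cube:
  fixes z :: "'a::euclidean_space"
  assumes "z \<in> cbox (-One) One"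
  shows "norm z \<le> real DIM('a)"
proof -
  have "norm z \<le> (\<Sum>b\<in>Basis. \<bar>z \<bullet> b\<bar>)"
    by (rule norm_le_l1)
  also have "\<dots> \<le> (\<Sum>b\<in>(Basis::'a set). 1)"
    using assms by (intro sum_mono) (auto simp: mem_box abs_le_iff minus_le_iff)
  finally show ?thesis by simp
qed

lemma cube_point_in_ball:
  fixes w :: "'a::euclidean_space"
  assumes "z \<in> cbox (-One) One" "0 < r"
  shows "w + r *\<^sub>R z \<in> ball w (r * (real DIM('a) + 1))"
  using norm_le_DIM_of_mem_centered_cube[OF assms(1)] assms(2) by (auto simp: dist_norm)

lemma dist_cube_point_le:
  fixes w :: "'a::euclidean_space"
  assumes "z \<in> cbox (-One) One"
  shows "dist (w + r *\<^sub>R z) x \<le> dist w x + \<bar>r\<bar> * real DIM('a)"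
proof -
  have "dist (w + r *\<^sub>R z) x \<le> dist w x + \<bar>r\<bar> * norm z"
    by (metis add.commute add_diff_eq dist_norm norm_scaleR norm_triangle_ineq)
  also have "\<dots> \<le> dist w x + \<bar>r\<bar> * real DIM('a)"
    using norm_le_DIM_of_mem_centered_cube[OF assms] by (simp add: mult_left_mono)
  finally show ?thesis .
qed

lemma tendsto_cube_mean:
  fixes u :: "'a::euclidean_space \<Rightarrow> real"
  assumes cont: "continuous_on \<Omega> u" and "open \<Omega>" "x \<in> \<Omega>"
    and lim: "w \<longlonglongrightarrow> x" "r \<longlonglongrightarrow> 0"
  shows "(\<lambda>j. cube_mean u (w j) (r j)) \<longlonglongrightarrow> u x"
proof (rule tendstoI)
  fix e :: real assume "0 < e"
  have "isCont u x" using assms by (simp add: continuous_on_eq_continuous_at)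
  then obtain d where d: "d > 0" "\<And>y. dist y x < d \<Longrightarrow> dist (u y) (u x) < e / 2"
    using \<open>0 < e\<close> unfolding continuous_at_eps_delta by (meson half_gt_zero)
  obtain d' where d': "d' > 0" "ball x d' \<subseteq> \<Omega>" using \<open>open \<Omega>\<close> \<open>x \<in> \<Omega>\<close> openE by blast
  have "(\<lambda>j. dist (w j) x + \<bar>r j\<bar> * real DIM('a)) \<longlonglongrightarrow> 0 + \<bar>0\<bar> * real DIM('a)"
    using lim by (intro tendsto_intros) (simp flip: tendsto_dist_iff)
  then have "\<forall>\<^sub>F j in sequentially. dist (w j) x + \<bar>r j\<bar> * real DIM('a) < min d d'"
    using d d' by (intro order_tendstoD) auto
  then show "\<forall>\<^sub>F j in sequentially. dist (cube_mean u (w j) (r j)) (u x) < e"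
  proof eventually_elim
    case (elim j)
    have close: "dist (w j + r j *\<^sub>R z) x < min d d'" if "z \<in> cbox (-One) One" for z
      using dist_cube_point_le[OF that, of "w j" "r j" x] elim by simp
    have cont_cube: "continuous_on (cbox (-One) One) (\<lambda>z. u (w j + r j *\<^sub>R z))"
      using close d'(2)
      by (intro continuous_on_compose2[OF cont] continuous_intros) (force simp: dist_commute)
    have "cube_mean u (w j) (r j) - u x
        = integral (cbox (-One) One) (\<lambda>z. u (w j + r j *\<^sub>R z) - u x) / 2 ^ DIM('a)"
      unfolding cube_mean_def
      by (subst integral_diff)
        (auto intro: integrable_continuous cont_cube simp: content_centered_cube diff_divide_distrib)
    also have "norm \<dots> \<le> integral (cbox (-One) (One::'a)) (\<lambda>z. e / 2) / 2 ^ DIM('a)"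
      unfolding norm_divide using close d(2)
      by (intro divide_mono integral_norm_bound_integral integrable_continuous continuous_intros cont_cube)
        (force simp: dist_real_def intro: less_imp_le)+
    also have "\<dots> < e" using \<open>0 < e\<close> by (simp add: content_centered_cube)
    finally show ?case by (simp add: dist_norm)
  qed
qed

lemma nn_integral_affine_euclidean:
  fixes F :: "'a::euclidean_space \<Rightarrow> ennreal"
  assumes [measurable]: "F \<in> borel_measurable borel" and "c > 0"
  shows "(\<integral>\<^sup>+y. F y \<partial>lborel) = ennreal (c ^ DIM('a)) * (\<integral>\<^sup>+z. F (t + c *\<^sub>R z) \<partial>lborel)"
  using \<open>c > 0\<close>
  by (subst lborel_affine[of c t])
    (auto simp: nn_integral_density nn_integral_distr nn_integral_cmult)

lemma cube_mean_le_ball_integral: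
  fixes f :: "'a::euclidean_space \<Rightarrow> real"
  defines "n \<equiv> real DIM('a)"
  assumes r: "0 < r" and cont: "continuous_on (ball w (r * (n + 1))) f"
    and nonneg: "\<And>y. y \<in> ball w (r * (n + 1)) \<Longrightarrow> 0 \<le> f y"
  shows "ennreal (cube_mean f w r) \<le> ennreal (r powr - n) * ball_integral f w (r * (n + 1))"
proof -
  define Q where "Q = cbox (-One) (One :: 'a)"
  define B where "B = ball w (r * (n + 1))"
  have in_ball: "w + r *\<^sub>R z \<in> B" if "z \<in> Q" for z
    using cube_point_in_ball[of z r w] that r by (simp add: B_def Q_def n_def)
  have [measurable]: "B \<in> sets borel" by (simp add: B_def)
  define h where "h = (\<lambda>y. indicator B y * f y)"
  have [measurable]: "h \<in> borel_measurable borel"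
    unfolding h_def using borel_measurable_continuous_on_indicator[of B f] cont by (simp add: B_def)
  define I where "I = integral Q (\<lambda>z. f (w + r *\<^sub>R z))"
  have "continuous_on Q (\<lambda>z. f (w + r *\<^sub>R z))"
    using in_ball unfolding B_def by (intro continuous_on_compose2[OF cont] continuous_intros) auto
  then have I: "((\<lambda>z. f (w + r *\<^sub>R z)) has_integral I) Q"
    unfolding I_def Q_def by (intro integrable_integral integrable_continuous)
  have f_nonneg: "0 \<le> f (w + r *\<^sub>R z)" if "z \<in> Q" for z
    using nonneg in_ball[OF that] by (simp add: B_def)
  have "ennreal I = (\<integral>\<^sup>+z\<in>Q. ennreal (f (w + r *\<^sub>R z)) \<partial>lborel)"
    using nn_integral_has_integral_lebesgue'[OF f_nonneg I] by simp
  also have "\<dots> \<le> (\<integral>\<^sup>+z. ennreal (h (w + r *\<^sub>R z)) \<partial>lborel)"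
    using in_ball by (intro nn_integral_mono) (auto simp: h_def split: split_indicator)
  also have "\<dots> = ennreal (r powr - n) * (ennreal (r ^ DIM('a)) * \<dots>)"
    using r by (simp add: mult.assoc[symmetric] ennreal_mult[symmetric] powr_minus powr_realpow n_def)
  also have "ennreal (r ^ DIM('a)) * (\<integral>\<^sup>+z. ennreal (h (w + r *\<^sub>R z)) \<partial>lborel) = (\<integral>\<^sup>+y. ennreal (h y) \<partial>lborel)"
    using r by (intro nn_integral_affine_euclidean[symmetric]) measurable
  also have "\<dots> = (\<integral>\<^sup>+y\<in>B. ennreal (f y) \<partial>lborel)"
    by (intro nn_integral_cong) (auto simp: h_def split: split_indicator)
  finally have I_le: "ennreal I \<le> ennreal (r powr - n) * (\<integral>\<^sup>+y\<in>B. ennreal (f y) \<partial>lborel)" .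
  have "0 \<le> I" by (rule has_integral_nonneg[OF I f_nonneg])
  then have "I / 2 ^ DIM('a) \<le> I / 1" by (intro divide_left_mono) auto
  with I_le show ?thesis
    by (auto simp: cube_mean_def I_def Q_def B_def intro: order_trans[OF ennreal_leI])
qed

lemma convex_interpolation_bounds:
  fixes r r' t :: real
  assumes "r' \<le> r" "t \<in> {0..1}"
  shows "r' \<le> r + t * (r' - r)" "r + t * (r' - r) \<le> r"
proof -
  have "t * (r - r') \<le> 1 * (r - r')" "0 \<le> t * (r - r')"
    using assms by (intro mult_right_mono mult_nonneg_nonneg; simp)+
  then show "r' \<le> r + t * (r' - r)" "r + t * (r' - r) \<le> r" by (auto simp: algebra_simps)
qed

lemma ball_convex_interpolation_subset:
  fixes w w' :: "'a::real_normed_vector"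
  assumes "0 \<le> r" "r' \<le> r" "dist w w' \<le> r" "t \<in> {0..1}" "0 \<le> k"
  shows "ball (w + t *\<^sub>R (w' - w)) ((r + t * (r' - r)) * k) \<subseteq> ball w (r * (k + 1))"
proof
  fix y assume y: "y \<in> ball (w + t *\<^sub>R (w' - w)) ((r + t * (r' - r)) * k)"
  have "dist w (w + t *\<^sub>R (w' - w)) = t * dist w w'" using assms by (simp add: dist_norm norm_minus_commute)
  also have "\<dots> \<le> 1 * r" using assms by (intro mult_mono) auto
  finally have "dist w (w + t *\<^sub>R (w' - w)) \<le> r" by simp
  moreover have "(r + t * (r' - r)) * k \<le> r * k"
    using convex_interpolation_bounds(2)[of r' r t] assms by (intro mult_right_mono) auto
  ultimately show "y \<in> ball w (r * (k + 1))"
    using y dist_triangle[of w y "w + t *\<^sub>R (w' - w)"] by (simp add: algebra_simps)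
qed

locale C1_gradient =
  fixes \<Omega> :: "'a::euclidean_space set" and u :: "'a \<Rightarrow> real" and g :: "'a \<Rightarrow> 'a"
  assumes open_domain: "open \<Omega>"
    and has_gradient: "x \<in> \<Omega> \<Longrightarrow> (u has_derivative (\<lambda>h. g x \<bullet> h)) (at x)"
    and continuous_gradient: "continuous_on \<Omega> g"
begin

lemma continuous_on_domain: "continuous_on \<Omega> u"
  using has_gradient has_derivative_continuous continuous_at_imp_continuous_on by blast

definition grad_norm :: "'a \<Rightarrow> real" where
  "grad_norm y = indicator \<Omega> y * norm (g y)"

lemma borel_measurable_grad_norm [measurable]: "grad_norm \<in> borel_measurable borel"
  unfolding grad_norm_def
  using borel_measurable_continuous_on_indicator[of \<Omega> "\<lambda>y. norm (g y)"]
    open_domain continuous_gradient continuous_on_norm by auto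

lemma continuous_on_grad_norm: "continuous_on \<Omega> grad_norm"
  using continuous_on_norm[OF continuous_gradient]
  by (rule continuous_on_eq) (simp add: grad_norm_def)

lemma has_field_derivative_cube_mean:
  assumes dom: "\<And>t z. t \<in> {0..1} \<Longrightarrow> z \<in> cbox (-One) One \<Longrightarrow> w + t *\<^sub>R v + (r + t * d) *\<^sub>R z \<in> \<Omega>"
    and "t \<in> {0..1}"
  shows "((\<lambda>t. cube_mean u (w + t *\<^sub>R v) (r + t * d)) has_field_derivative
    integral (cbox (-One) One) (\<lambda>z. g (w + t *\<^sub>R v + (r + t * d) *\<^sub>R z) \<bullet> (v + d *\<^sub>R z)) / 2 ^ DIM('a))
    (at t within {0..1})"
  unfolding cube_mean_def
proof (intro DERIV_cdivide leibniz_rule_field_derivative)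
  fix t' z assume t'z: "t' \<in> {0..1::real}" "z \<in> cbox (-One::'a) One"
  have "((\<lambda>t. w + t *\<^sub>R v + (r + t * d) *\<^sub>R z) has_derivative (\<lambda>h. h *\<^sub>R (v + d *\<^sub>R z))) (at t' within {0..1})"
    by (auto intro!: derivative_eq_intros simp: algebra_simps)
  from has_derivative_compose[OF this has_gradient[OF dom[OF t'z]]]
  show "((\<lambda>t. u (w + t *\<^sub>R v + (r + t * d) *\<^sub>R z)) has_field_derivative
      g (w + t' *\<^sub>R v + (r + t' * d) *\<^sub>R z) \<bullet> (v + d *\<^sub>R z)) (at t' within {0..1})"
    by (simp add: has_field_derivative_def mult_commute_abs)
next
  fix t' assume "t' \<in> {0..1::real}"
  then show "(\<lambda>z. u (w + t' *\<^sub>R v + (r + t' * d) *\<^sub>R z)) integrable_on cbox (-One) One"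
    using dom
    by (intro integrable_continuous continuous_on_compose2[OF continuous_on_domain] continuous_intros) auto
next
  show "continuous_on ({0..1} \<times> cbox (-One) One)
      (\<lambda>(t, z). g (w + t *\<^sub>R v + (r + t * d) *\<^sub>R z) \<bullet> (v + d *\<^sub>R z))"
    unfolding split_beta using dom
    by (intro continuous_on_inner continuous_on_compose2[OF continuous_gradient] continuous_intros) auto
qed (use assms in auto)

lemma abs_integral_gradient_le_cube_mean:
  assumes dom: "\<And>z. z \<in> cbox (-One) One \<Longrightarrow> w + r *\<^sub>R z \<in> \<Omega>"
  shows "\<bar>integral (cbox (-One) One) (\<lambda>z. g (w + r *\<^sub>R z) \<bullet> (v + d *\<^sub>R z)) / 2 ^ DIM('a)\<bar>
    \<le> (norm v + \<bar>d\<bar> * real DIM('a)) * cube_mean grad_norm w r"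
proof -
  define L where "L = norm v + \<bar>d\<bar> * real DIM('a)"
  have cont: "continuous_on (cbox (-One) One) (\<lambda>z. grad_norm (w + r *\<^sub>R z))"
    "continuous_on (cbox (-One) One) (\<lambda>z. g (w + r *\<^sub>R z) \<bullet> (v + d *\<^sub>R z))"
    using dom
    by (intro continuous_on_compose2[OF continuous_on_grad_norm] continuous_on_inner
        continuous_on_compose2[OF continuous_gradient] continuous_intros; auto)+
  have "norm (integral (cbox (-One) One) (\<lambda>z. g (w + r *\<^sub>R z) \<bullet> (v + d *\<^sub>R z)))
      \<le> integral (cbox (-One) One) (\<lambda>z. L * grad_norm (w + r *\<^sub>R z))"
  proof (rule integral_norm_bound_integral)
    fix z :: 'a assume z: "z \<in> cbox (-One) One"
    have "norm (v + d *\<^sub>R z) \<le> norm v + \<bar>d\<bar> * norm z"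
      by (metis norm_scaleR norm_triangle_ineq)
    also have "\<dots> \<le> L"
      unfolding L_def using norm_le_DIM_of_mem_centered_cube[OF z] by (intro add_left_mono mult_left_mono) auto
    finally have "norm (g (w + r *\<^sub>R z)) * norm (v + d *\<^sub>R z) \<le> norm (g (w + r *\<^sub>R z)) * L"
      by (rule mult_left_mono) simp
    then show "norm (g (w + r *\<^sub>R z) \<bullet> (v + d *\<^sub>R z)) \<le> L * grad_norm (w + r *\<^sub>R z)"
      using Cauchy_Schwarz_ineq2[of "g (w + r *\<^sub>R z)" "v + d *\<^sub>R z"] dom[OF z]
      by (simp add: grad_norm_def mult.commute)
  qed (use cont in \<open>auto intro!: integrable_continuous continuous_intros\<close>)
  then show ?thesis
    by (simp add: cube_mean_def L_def divide_right_mono)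
qed

lemma abs_diff_cube_mean_le:
  assumes dom: "\<And>t z. t \<in> {0..1} \<Longrightarrow> z \<in> cbox (-One) One \<Longrightarrow> w + t *\<^sub>R v + (r + t * d) *\<^sub>R z \<in> \<Omega>"
    and mean_le: "\<And>t. t \<in> {0..1} \<Longrightarrow> cube_mean grad_norm (w + t *\<^sub>R v) (r + t * d) \<le> M"
  shows "\<bar>cube_mean u (w + v) (r + d) - cube_mean u w r\<bar> \<le> (norm v + \<bar>d\<bar> * real DIM('a)) * M"
proof -
  have "norm (cube_mean u (w + 1 *\<^sub>R v) (r + 1 * d) - cube_mean u (w + 0 *\<^sub>R v) (r + 0 * d))
      \<le> (norm v + \<bar>d\<bar> * real DIM('a)) * M * norm (1 - 0 :: real)"
  proof (rule field_differentiable_bound[of "{0..1}", OF _ has_field_derivative_cube_mean[OF dom]])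
    fix t :: real assume t: "t \<in> {0..1}"
    have "(norm v + \<bar>d\<bar> * real DIM('a)) * cube_mean grad_norm (w + t *\<^sub>R v) (r + t * d)
        \<le> (norm v + \<bar>d\<bar> * real DIM('a)) * M"
      using mean_le[OF t] by (intro mult_left_mono) auto
    with abs_integral_gradient_le_cube_mean[OF dom[OF t], where v = v and d = d]
    show "norm (integral (cbox (-One) One) (\<lambda>z. g (w + t *\<^sub>R v + (r + t * d) *\<^sub>R z) \<bullet> (v + d *\<^sub>R z)) / 2 ^ DIM('a))
        \<le> (norm v + \<bar>d\<bar> * real DIM('a)) * M"
      by simp
  qed auto
  then show ?thesis by simp
qed

lemma cube_mean_grad_norm_le:
  defines "n \<equiv> real DIM('a)"
  assumes r: "0 < r'" "r' \<le> r" and sub: "ball w (r * (n + 1)) \<subseteq> B" "B \<subseteq> \<Omega>"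
  shows "ennreal (cube_mean grad_norm w r) \<le> ennreal (r' powr - n) * (\<integral>\<^sup>+y\<in>B. ennreal (grad_norm y) \<partial>lborel)"
proof -
  have "ennreal (cube_mean grad_norm w r) \<le> ennreal (r powr - n) * ball_integral grad_norm w (r * (n + 1))"
    unfolding n_def using r sub
    by (intro cube_mean_le_ball_integral continuous_on_subset[OF continuous_on_grad_norm])
      (auto simp: grad_norm_def n_def)
  also have "\<dots> \<le> ennreal (r' powr - n) * (\<integral>\<^sup>+y\<in>B. ennreal (grad_norm y) \<partial>lborel)"
    using r by (intro mult_mono nn_set_integral_set_mono sub ennreal_leI powr_mono2') (auto simp: n_def)
  finally show ?thesis .
qed

lemma abs_diff_cube_mean_le_ball_integral:
  defines "n \<equiv> real DIM('a)"
  assumes r: "0 < r'" "r' \<le> r" and near: "dist w w' \<le> r"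
    and sub: "ball w (r * (n + 2)) \<subseteq> \<Omega>"
  shows "ennreal \<bar>cube_mean u w r - cube_mean u w' r'\<bar>
    \<le> ennreal ((n + 1) * r * r' powr - n) * ball_integral grad_norm w (r * (n + 2))"
proof (cases "ball_integral grad_norm w (r * (n + 2))")
  case top
  then show ?thesis using r by (simp add: n_def ennreal_mult_top)
next
  case (real j)
  define B where "B = ball w (r * (n + 2))"
  note radius = convex_interpolation_bounds[OF r(2)]
  have ball_sub: "ball (w + t *\<^sub>R (w' - w)) ((r + t * (r' - r)) * (n + 1)) \<subseteq> B" if "t \<in> {0..1}" for t
    using ball_convex_interpolation_subset[OF _ r(2) near that, of "n + 1"] r by (simp add: B_def n_def add_ac)
  have mean_le: "cube_mean grad_norm (w + t *\<^sub>R (w' - w)) (r + t * (r' - r)) \<le> r' powr - n * j"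
    if t: "t \<in> {0..1}" for t
  proof -
    have "ennreal (cube_mean grad_norm (w + t *\<^sub>R (w' - w)) (r + t * (r' - r))) \<le> ennreal (r' powr - n) * ennreal j"
      using ball_sub[OF t] sub radius(1)[OF t] r unfolding n_def real(2)[symmetric]
      by (intro cube_mean_grad_norm_le) (auto simp: n_def B_def)
    also have "\<dots> = ennreal (r' powr - n * j)" using real by (simp add: ennreal_mult)
    finally show ?thesis using real by (subst (asm) ennreal_le_iff) auto
  qed
  have "\<bar>cube_mean u (w + (w' - w)) (r + (r' - r)) - cube_mean u w r\<bar>
      \<le> (norm (w' - w) + \<bar>r' - r\<bar> * real DIM('a)) * (r' powr - n * j)"
  proof (rule abs_diff_cube_mean_le[OF _ mean_le])
    fix t :: real and z :: 'a assume t: "t \<in> {0..1}" and z: "z \<in> cbox (-One) One"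
    then show "w + t *\<^sub>R (w' - w) + (r + t * (r' - r)) *\<^sub>R z \<in> \<Omega>"
      using cube_point_in_ball[OF z, of "r + t * (r' - r)"] ball_sub[OF t] sub radius(1)[OF t] r
      by (force simp: B_def n_def)
  qed
  also have "\<dots> \<le> (r + r * n) * (r' powr - n * j)"
    using near r real by (intro mult_right_mono add_mono mult_mono) (auto simp: dist_norm norm_minus_commute n_def)
  finally have "\<bar>cube_mean u w r - cube_mean u w' r'\<bar> \<le> (n + 1) * r * r' powr - n * j"
    by (simp add: abs_minus_commute algebra_simps)
  then have "ennreal \<bar>cube_mean u w r - cube_mean u w' r'\<bar> \<le> ennreal ((n + 1) * r * r' powr - n * j)"
    by (rule ennreal_leI)
  also have "\<dots> = ennreal ((n + 1) * r * r' powr - n) * ennreal j"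
    using real r by (simp add: ennreal_mult n_def)
  finally show ?thesis by (simp add: real)
qed

end

subsection \<open>Chains along curves\<close>

definition chain_in :: "'a::metric_space set \<Rightarrow> real \<Rightarrow> (nat \<Rightarrow> 'a) \<Rightarrow> nat \<Rightarrow> bool" where
  "chain_in K r v l \<longleftrightarrow> (\<forall>i\<le>l. v i \<in> K) \<and> (\<forall>i<l. dist (v i) (v (Suc i)) \<le> r)"

definition unshortenable :: "real \<Rightarrow> (nat \<Rightarrow> 'a::metric_space) \<Rightarrow> nat \<Rightarrow> bool" where
  "unshortenable r v l \<longleftrightarrow> (\<forall>i k. i + 2 \<le> k \<longrightarrow> k \<le> l \<longrightarrow> r < dist (v i) (v k))"

lemma chain_in_shortcut:
  assumes chain: "chain_in K r v l" and ik: "i + 2 \<le> k" "k \<le> l" and near: "dist (v i) (v k) \<le> r"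
  obtains v' l' where "l' < l" "chain_in K r v' l'" "v' 0 = v 0" "v' l' = v l"
proof
  define e where "e = k - i - 1"
  have e: "e > 0" "k = i + 1 + e" "e \<le> l" using ik by (auto simp: e_def)
  define v' where "v' = (\<lambda>j. if j \<le> i then v j else v (j + e))"
  show "l - e < l" "v' 0 = v 0" "v' (l - e) = v l" using e ik by (auto simp: v'_def)
  have "dist (v' j) (v' (Suc j)) \<le> r" if "j < l - e" for j
  proof -
    consider "j < i" | "j = i" | "j > i" by linarith
    then show ?thesis
      using chain near that e ik by cases (auto simp: chain_in_def v'_def)
  qed
  then show "chain_in K r v' (l - e)"
    using chain e ik by (auto simp: chain_in_def v'_def)
qed

lemma obtain_unshortenable_chain:
  assumes "chain_in K r w m"
  obtains v l where "chain_in K r v l" "v 0 = w 0" "v l = w m" "unshortenable r v l"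
  using assms
proof (induction m arbitrary: w thesis rule: less_induct)
  case (less m)
  show ?case
  proof (cases "unshortenable r w m")
    case True
    with less.prems show ?thesis by blast
  next
    case False
    then obtain i k where "i + 2 \<le> k" "k \<le> m" "dist (w i) (w k) \<le> r"
      by (auto simp: unshortenable_def not_less)
    with less.prems(2) obtain w' m' where "m' < m" "chain_in K r w' m'" "w' 0 = w 0" "w' m' = w m"
      by (rule chain_in_shortcut)
    then show ?thesis using less.IH[of m' w'] less.prems(1) by metis
  qed
qed

lemma obtain_unshortenable_chain_along_curve:
  fixes \<eta> :: "real \<Rightarrow> 'a::metric_space"
  assumes lip: "1-lipschitz_on {a..b} \<eta>" and "a \<le> b" "0 < r"
  obtains v l where "chain_in (\<eta> ` {a..b}) r v l" "v 0 = \<eta> a" "v l = \<eta> b" "unshortenable r v l"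
proof -
  obtain m' :: nat where "(b - a) / r < m'" using reals_Archimedean2 by blast
  then obtain m :: nat where m: "m > 0" "(b - a) / r < m" by (intro that[of "Suc m'"]) auto
  define \<tau> where "\<tau> = (\<lambda>i. a + real i * ((b - a) / m))"
  have \<tau>: "\<tau> i \<in> {a..b}" if "i \<le> m" for i
  proof -
    have "real i * ((b - a) / m) \<le> real m * ((b - a) / m)"
      using that \<open>a \<le> b\<close> by (intro mult_right_mono) auto
    then show ?thesis using m \<open>a \<le> b\<close> by (simp add: \<tau>_def)
  qed
  have "dist (\<eta> (\<tau> i)) (\<eta> (\<tau> (Suc i))) \<le> r" if "i < m" for i
  proof -
    have "dist (\<eta> (\<tau> i)) (\<eta> (\<tau> (Suc i))) \<le> 1 * dist (\<tau> i) (\<tau> (Suc i))"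
      using that by (intro lipschitz_onD[OF lip] \<tau>) auto
    also have "\<dots> = (b - a) / m" using \<open>a \<le> b\<close> m by (simp add: \<tau>_def dist_real_def field_simps)
    also have "\<dots> \<le> r" using m \<open>0 < r\<close> by (simp add: field_simps)
    finally show ?thesis .
  qed
  then have "chain_in (\<eta> ` {a..b}) r (\<lambda>i. \<eta> (\<tau> i)) m"
    using \<tau> by (auto simp: chain_in_def)
  moreover have "\<tau> 0 = a" "\<tau> m = b" using m by (auto simp: \<tau>_def)
  ultimately show ?thesis using obtain_unshortenable_chain that by metis
qed

lemma disjoint_family_balls_of_separated:
  fixes f :: "'i \<Rightarrow> 'a::metric_space"
  assumes "\<And>i k. i \<in> A \<Longrightarrow> k \<in> A \<Longrightarrow> i \<noteq> k \<Longrightarrow> r \<le> dist (f i) (f k)"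
  shows "disjoint_family_on (\<lambda>i. ball (f i) (r / 2)) A"
  unfolding disjoint_family_on_def
proof (intro ballI impI)
  fix i k assume ik: "i \<in> A" "k \<in> A" "i \<noteq> k"
  have "dist (f i) z < r / 2 \<Longrightarrow> dist (f k) z < r / 2 \<Longrightarrow> False" for z
    using dist_triangle_half_r[of z "f i" r "f k"] assms[OF ik] by (simp add: dist_commute)
  then show "ball (f i) (r / 2) \<inter> ball (f k) (r / 2) = {}" by auto
qed

lemma card_separated_in_ball_le:
  fixes f :: "'i \<Rightarrow> 'a::euclidean_space"
  assumes "finite A" "0 < r" "0 \<le> N"
    and sep: "\<And>i k. i \<in> A \<Longrightarrow> k \<in> A \<Longrightarrow> i \<noteq> k \<Longrightarrow> r \<le> dist (f i) (f k)"
    and near: "\<And>i. i \<in> A \<Longrightarrow> y \<in> ball (f i) (N * r)"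
  shows "real (card A) \<le> (2 * N + 1) ^ DIM('a)"
proof -
  define V where "V = unit_ball_vol (real DIM('a))"
  have V: "V > 0" by (simp add: V_def)
  have "ennreal (card A * (V * (r / 2) ^ DIM('a))) = (\<Sum>i\<in>A. emeasure lborel (ball (f i) (r / 2)))"
    using \<open>0 < r\<close> V by (simp add: emeasure_ball V_def ennreal_mult ennreal_of_nat_eq_real_of_nat)
  also have "\<dots> = emeasure lborel (\<Union>i\<in>A. ball (f i) (r / 2))"
    using disjoint_family_balls_of_separated[of A r f] sep \<open>finite A\<close> by (intro sum_emeasure) auto
  also have "\<dots> \<le> emeasure lborel (ball y ((N + 1/2) * r))"
  proof (rule emeasure_mono)
    show "(\<Union>i\<in>A. ball (f i) (r / 2)) \<subseteq> ball y ((N + 1/2) * r)"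
    proof clarify
      fix i z assume "i \<in> A" "z \<in> ball (f i) (r / 2)"
      then show "z \<in> ball y ((N + 1/2) * r)"
        using near[of i] dist_triangle[of y z "f i"] by (auto simp: dist_commute algebra_simps)
    qed
  qed auto
  also have "\<dots> = ennreal (V * ((N + 1/2) * r) ^ DIM('a))"
    using \<open>0 < r\<close> \<open>0 \<le> N\<close> by (simp add: emeasure_ball V_def)
  finally have "card A * (V * (r / 2) ^ DIM('a)) \<le> V * ((N + 1/2) * r) ^ DIM('a)"
    using V \<open>0 < r\<close> \<open>0 \<le> N\<close> by (subst (asm) ennreal_le_iff) auto
  also have "(N + 1/2) * r = (2 * N + 1) * (r / 2)" by (simp add: field_simps)
  finally have "card A * (V * (r / 2) ^ DIM('a)) \<le> (2 * N + 1) ^ DIM('a) * (V * (r / 2) ^ DIM('a))"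
    unfolding power_mult_distrib by (simp only: mult_ac)
  moreover have "0 < V * (r / 2) ^ DIM('a)" using V \<open>0 < r\<close> by simp
  ultimately show ?thesis by (rule mult_right_le_imp_le)
qed

lemma card_unshortenable_in_ball_le:
  fixes v :: "nat \<Rightarrow> 'a::euclidean_space"
  assumes "0 < r" "0 \<le> N" "unshortenable r v l"
  shows "real (card {i\<in>{..<l}. y \<in> ball (v i) (N * r)}) \<le> 2 * (2 * N + 1) ^ DIM('a)"
proof -
  define A where "A = (\<lambda>e. {i\<in>{..<l}. y \<in> ball (v i) (N * r) \<and> (even i = e)})"
  have parity: "real (card (A e)) \<le> (2 * N + 1) ^ DIM('a)" for e
  proof (rule card_separated_in_ball_le)
    fix i k assume ik: "i \<in> A e" "k \<in> A e" "i \<noteq> k"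
    then have "even i = even k" by (auto simp: A_def)
    with ik have "i + 2 \<le> k \<or> k + 2 \<le> i" by presburger
    then have "r < dist (v i) (v k) \<or> r < dist (v k) (v i)"
      using assms(3) ik unfolding unshortenable_def A_def by auto
    then show "r \<le> dist (v i) (v k)" by (auto simp: dist_commute)
  qed (use assms in \<open>auto simp: A_def\<close>)
  have "{i\<in>{..<l}. y \<in> ball (v i) (N * r)} = A True \<union> A False" by (auto simp: A_def)
  then have "card {i\<in>{..<l}. y \<in> ball (v i) (N * r)} \<le> card (A True) + card (A False)"
    by (simp add: card_Un_le)
  then show ?thesis using parity[of True] parity[of False] by linarith
qed

lemma dist_le_sum_dist:
  fixes U :: "nat \<Rightarrow> 'a::metric_space"
  shows "dist (U 0) (U N) \<le> (\<Sum>j<N. dist (U j) (U (Suc j)))"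
proof (induction N)
  case (Suc N)
  have "dist (U 0) (U (Suc N)) \<le> dist (U 0) (U N) + dist (U N) (U (Suc N))" by (rule dist_triangle)
  with Suc show ?case by simp
qed simp

lemma dist_lim_le_suminf_dist:
  fixes U :: "nat \<Rightarrow> 'a::metric_space"
  assumes "U \<longlonglongrightarrow> L"
  shows "ennreal (dist (U 0) L) \<le> (\<Sum>j. ennreal (dist (U j) (U (Suc j))))"
proof (rule LIMSEQ_le_const2)
  show "(\<lambda>N. ennreal (dist (U 0) (U N))) \<longlonglongrightarrow> ennreal (dist (U 0) L)"
    by (intro tendsto_ennrealI tendsto_intros assms)
  have "ennreal (dist (U 0) (U N)) \<le> (\<Sum>j. ennreal (dist (U j) (U (Suc j))))" for N
  proof -
    have "ennreal (dist (U 0) (U N)) \<le> (\<Sum>j<N. ennreal (dist (U j) (U (Suc j))))"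
      by (simp add: dist_le_sum_dist ennreal_leI)
    also have "\<dots> \<le> (\<Sum>j. ennreal (dist (U j) (U (Suc j))))"
      by (rule sum_le_suminf) auto
    finally show ?thesis .
  qed
  then show "\<exists>N. \<forall>n\<ge>N. ennreal (dist (U 0) (U n)) \<le> (\<Sum>j. ennreal (dist (U j) (U (Suc j))))"
    by blast
qed

lemma sum_nn_integral_le_of_bounded_overlap:
  assumes [measurable]: "F \<in> borel_measurable M" and A: "finite A" and B: "\<And>i. i \<in> A \<Longrightarrow> B i \<in> sets M"
    and [measurable]: "V \<in> sets M" and sub: "\<And>i. i \<in> A \<Longrightarrow> B i \<subseteq> V"
    and overlap: "\<And>y. real (card {i\<in>A. y \<in> B i}) \<le> N"
  shows "(\<Sum>i\<in>A. \<integral>\<^sup>+y\<in>B i. F y \<partial>M) \<le> ennreal N * (\<integral>\<^sup>+y\<in>V. F y \<partial>M)"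
proof -
  have "(\<Sum>i\<in>A. \<integral>\<^sup>+y\<in>B i. F y \<partial>M) = (\<integral>\<^sup>+y. (\<Sum>i\<in>A. F y * indicator (B i) y) \<partial>M)"
    using B by (subst nn_integral_sum) auto
  also have "\<dots> \<le> (\<integral>\<^sup>+y. ennreal N * (F y * indicator V y) \<partial>M)"
  proof (intro nn_integral_mono)
    fix y
    have "(\<Sum>i\<in>A. F y * indicator (B i) y) = F y * of_nat (card {i\<in>A. y \<in> B i})"
      using A by (simp add: sum_distrib_left[symmetric] indicator_def sum.If_cases Int_def)
    also have "\<dots> \<le> F y * (ennreal N * indicator V y)"
    proof (cases "{i\<in>A. y \<in> B i} = {}")
      case False
      then have "y \<in> V" using sub by blast
      then show ?thesis using overlap[of y]
        by (auto simp: ennreal_of_nat_eq_real_of_nat intro!: mult_left_mono)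
    next
      case True
      then show ?thesis by (simp only: card.empty) simp
    qed
    finally show "(\<Sum>i\<in>A. F y * indicator (B i) y) \<le> ennreal N * (F y * indicator V y)" by (simp add: mult_ac)
  qed
  also have "\<dots> = ennreal N * (\<integral>\<^sup>+y\<in>V. F y \<partial>M)" by (rule nn_integral_cmult) measurable
  finally show ?thesis .
qed

text \<open>An unshortenable chain has boundedly many steps near any point, so the length of the curve
  does not enter.\<close>

lemma (in C1_gradient) abs_diff_cube_mean_along_curve_le:
  fixes \<eta> :: "real \<Rightarrow> 'a"
  defines "n \<equiv> real DIM('a)"
  assumes "0 < r" "a \<le> b" and lip: "1-lipschitz_on {a..b} \<eta>" and V: "V \<in> sets borel"
    and sub: "\<And>t. t \<in> {a..b} \<Longrightarrow> ball (\<eta> t) (r * (n + 2)) \<subseteq> \<Omega> \<inter> V"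
  shows "ennreal \<bar>cube_mean u (\<eta> a) r - cube_mean u (\<eta> b) r\<bar>
    \<le> ennreal ((n + 1) * r powr (1 - n) * (2 * (2 * n + 5) powr n)) * (\<integral>\<^sup>+y\<in>V. ennreal (grad_norm y) \<partial>lborel)"
proof -
  obtain v l where chain: "chain_in (\<eta> ` {a..b}) r v l" and ends: "v 0 = \<eta> a" "v l = \<eta> b"
    and unshort: "unshortenable r v l"
    using obtain_unshortenable_chain_along_curve[OF lip \<open>a \<le> b\<close> \<open>0 < r\<close>] .
  define B where "B = (\<lambda>i. ball (v i) (r * (n + 2)))"
  have B: "B i \<subseteq> \<Omega> \<inter> V" if "i < l" for i
  proof -
    have "v i \<in> \<eta> ` {a..b}" using chain that by (simp add: chain_in_def)
    then obtain t where "t \<in> {a..b}" "v i = \<eta> t" by blast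
    then show ?thesis using sub[of t] by (simp only: B_def)
  qed
  have overlap: "real (card {i\<in>{..<l}. y \<in> B i}) \<le> 2 * (2 * n + 5) powr n" for y
    using card_unshortenable_in_ball_le[OF \<open>0 < r\<close> _ unshort, of "n + 2" y]
    by (simp add: B_def n_def powr_realpow mult.commute algebra_simps)
  define K where "K = (n + 1) * r * r powr - n"
  have K: "K = (n + 1) * r powr (1 - n)" using \<open>0 < r\<close> by (simp add: K_def powr_diff powr_minus field_simps)
  have "ennreal \<bar>cube_mean u (v 0) r - cube_mean u (v l) r\<bar>
      \<le> ennreal (\<Sum>i<l. \<bar>cube_mean u (v i) r - cube_mean u (v (Suc i)) r\<bar>)"
    using dist_le_sum_dist[of "\<lambda>i. cube_mean u (v i) r" l] by (simp add: dist_real_def ennreal_leI)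
  also have "\<dots> = (\<Sum>i<l. ennreal \<bar>cube_mean u (v i) r - cube_mean u (v (Suc i)) r\<bar>)" by simp
  also have "\<dots> \<le> (\<Sum>i<l. ennreal K * ball_integral grad_norm (v i) (r * (n + 2)))"
    unfolding K_def n_def using \<open>0 < r\<close> chain B
    by (intro sum_mono abs_diff_cube_mean_le_ball_integral) (auto simp: chain_in_def B_def n_def)
  also have "\<dots> \<le> ennreal K * (ennreal (2 * (2 * n + 5) powr n) * (\<integral>\<^sup>+y\<in>V. ennreal (grad_norm y) \<partial>lborel))"
    unfolding sum_distrib_left[symmetric] B_def[symmetric] using V B overlap
    by (intro mult_left_mono sum_nn_integral_le_of_bounded_overlap) (auto simp: B_def)
  also have "\<dots> = ennreal ((n + 1) * r powr (1 - n) * (2 * (2 * n + 5) powr n)) *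
      (\<integral>\<^sup>+y\<in>V. ennreal (grad_norm y) \<partial>lborel)"
    by (simp add: K n_def ennreal_mult mult_ac)
  finally show ?thesis by (simp add: ends)
qed

subsection \<open>The pointwise estimate in John domains\<close>

definition dyadic_riesz_potential :: "real \<Rightarrow> real \<Rightarrow> ('a::euclidean_space \<Rightarrow> real) \<Rightarrow> 'a \<Rightarrow> ennreal" where
  "dyadic_riesz_potential a R f x =
     (\<Sum>j. ennreal ((R / 2 ^ j) powr (a - real DIM('a))) * ball_integral f x (R / 2 ^ j))"

definition john_curve :: "real \<Rightarrow> real \<Rightarrow> real \<Rightarrow> 'a::metric_space set \<Rightarrow> (real \<Rightarrow> 'a) \<Rightarrow> bool" where
  "john_curve s c T \<Omega> \<eta> \<longleftrightarrow>
     1-lipschitz_on {0..T} \<eta> \<and> (\<forall>t\<in>{0<..T}. ball (\<eta> t) (c * t powr s) \<subseteq> \<Omega>)"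

lemma ball_infdist_frontier_subset:
  fixes z :: "'a::real_normed_vector"
  assumes "z \<in> S"
  shows "ball z (infdist z (frontier S)) \<subseteq> S"
proof (rule ccontr)
  let ?B = "ball z (infdist z (frontier S))"
  assume "\<not> ?B \<subseteq> S"
  then have "?B - S \<noteq> {}" by blast
  then have "0 < infdist z (frontier S)"
    by (metis ball_eq_empty Diff_empty empty_Diff not_le)
  then have "?B \<inter> S \<noteq> {}" using assms by (metis centre_in_ball disjoint_iff)
  with \<open>?B - S \<noteq> {}\<close> have "?B \<inter> frontier S \<noteq> {}"
    by (intro connected_Int_frontier) auto
  then show False by (metis disjoint_iff infdist_le mem_ball not_le)
qed

lemma arclength_param_dist_le:
  assumes "arclength_param \<gamma> l" "0 \<le> t1" "t1 \<le> t2" "t2 \<le> l"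
  shows "dist (\<gamma> t1) (\<gamma> t2) \<le> t2 - t1"
proof -
  define p where "p = (\<lambda>i::nat. if i = 0 then t1 else t2, 1::nat)"
  have "ennreal (\<Sum>i<snd p. dist (\<gamma> (fst p (Suc i))) (\<gamma> (fst p i))) \<le> curve_length \<gamma> t1 t2"
    unfolding curve_length_def by (rule SUP_upper) (use assms in \<open>auto simp: p_def\<close>)
  also have "\<dots> = ennreal (t2 - t1)" using assms by (simp add: arclength_param_def)
  finally show ?thesis using assms by (simp add: p_def dist_commute)
qed

lemma arclength_param_lipschitz:
  assumes "arclength_param \<gamma> l"
  shows "1-lipschitz_on {0..l} \<gamma>"
proof (rule lipschitz_on_leI)
  fix x y assume "x \<in> {0..l}" "y \<in> {0..l}" "x \<le> y"
  then show "dist (\<gamma> x) (\<gamma> y) \<le> 1 * dist x y"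
    using arclength_param_dist_le[OF assms, of x y] by (simp add: dist_real_def)
qed simp

lemma arclength_param_imp_john_curve:
  fixes \<gamma> :: "real \<Rightarrow> 'a::euclidean_space"
  assumes \<gamma>: "arclength_param \<gamma> l" "l \<le> T" and "0 \<le> s" "c \<le> cJ" "0 \<le> c"
    and dist: "\<And>t. t \<in> {0..l} \<Longrightarrow> \<gamma> t \<in> \<Omega> \<and> cJ * t powr s \<le> infdist (\<gamma> t) (frontier \<Omega>)"
    and end_ball: "ball (\<gamma> l) (c * T powr s) \<subseteq> \<Omega>"
  shows "john_curve s c T \<Omega> (\<lambda>t. \<gamma> (min t l))"
  unfolding john_curve_def
proof (intro conjI ballI)
  have l: "0 \<le> l" using \<gamma> by (simp add: arclength_param_def)
  have "1-lipschitz_on {0..T} (\<lambda>t. min t l)"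
    by (rule lipschitz_onI) (auto simp: dist_real_def min_def)
  moreover have "1-lipschitz_on ((\<lambda>t. min t l) ` {0..T}) \<gamma>"
    using arclength_param_lipschitz[OF \<gamma>(1)] l by (auto elim: lipschitz_on_subset)
  ultimately have "(1 * 1)-lipschitz_on {0..T} (\<lambda>t. \<gamma> (min t l))"
    by (rule lipschitz_on_compose2)
  then show "1-lipschitz_on {0..T} (\<lambda>t. \<gamma> (min t l))" by simp
  fix t assume t: "t \<in> {0<..T}"
  show "ball (\<gamma> (min t l)) (c * t powr s) \<subseteq> \<Omega>"
  proof (cases "t \<le> l")
    case True
    have "c * t powr s \<le> cJ * t powr s" using \<open>c \<le> cJ\<close> by (intro mult_right_mono) auto
    also have "\<dots> \<le> infdist (\<gamma> t) (frontier \<Omega>)" using dist[of t] t True by simp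
    finally have "ball (\<gamma> t) (c * t powr s) \<subseteq> ball (\<gamma> t) (infdist (\<gamma> t) (frontier \<Omega>))"
      by (rule subset_ball)
    also have "\<dots> \<subseteq> \<Omega>" using dist[of t] t True by (intro ball_infdist_frontier_subset) auto
    finally show ?thesis using True by simp
  next
    case False
    have "c * t powr s \<le> c * T powr s" using assms t by (intro mult_left_mono powr_mono2) auto
    then have "ball (\<gamma> l) (c * t powr s) \<subseteq> ball (\<gamma> l) (c * T powr s)" by (rule subset_ball)
    with end_ball show ?thesis using False by simp
  qed
qed

lemma s_john_domain_obtain_curves:
  fixes \<Omega> :: "'a::euclidean_space set"
  assumes "s_john_domain s \<Omega>"
  obtains c T :: real and x0 where "0 < c" "0 < T"
    "\<And>x. x \<in> \<Omega> \<Longrightarrow> \<exists>\<eta>. john_curve s c T \<Omega> \<eta> \<and> \<eta> 0 = x \<and> \<eta> T = x0"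
proof -
  from assms obtain cJ T x0 where s: "1 \<le> s" and \<Omega>: "open \<Omega>" and const: "0 < cJ" "0 < T" "x0 \<in> \<Omega>"
    and curve: "\<And>x. x \<in> \<Omega> \<Longrightarrow> \<exists>\<gamma> l. arclength_param \<gamma> l \<and> \<gamma> 0 = x \<and> \<gamma> l = x0 \<and> l \<le> T \<and>
           (\<forall>t\<in>{0..l}. \<gamma> t \<in> \<Omega> \<and> infdist (\<gamma> t) (frontier \<Omega>) \<ge> cJ * t powr s)"
    unfolding s_john_domain_def by metis
  obtain e where e: "e > 0" "ball x0 e \<subseteq> \<Omega>" using \<Omega> const openE by blast
  define c where "c = min cJ (e / T powr s)"
  have c: "c > 0" "c \<le> cJ" using const e by (auto simp: c_def)
  have "c * T powr s \<le> e / T powr s * T powr s" by (intro mult_right_mono) (auto simp: c_def)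
  then have "ball x0 (c * T powr s) \<subseteq> ball x0 e" using const by (intro subset_ball) auto
  with e have end_ball: "ball x0 (c * T powr s) \<subseteq> \<Omega>" by blast
  have "\<exists>\<eta>. john_curve s c T \<Omega> \<eta> \<and> \<eta> 0 = x \<and> \<eta> T = x0" if x: "x \<in> \<Omega>" for x
  proof -
    obtain \<gamma> l where \<gamma>: "arclength_param \<gamma> l" "\<gamma> 0 = x" "\<gamma> l = x0" "l \<le> T"
      "\<And>t. t \<in> {0..l} \<Longrightarrow> \<gamma> t \<in> \<Omega> \<and> cJ * t powr s \<le> infdist (\<gamma> t) (frontier \<Omega>)"
      using curve[OF x] by metis
    then have "john_curve s c T \<Omega> (\<lambda>t. \<gamma> (min t l))"
      using c s end_ball by (intro arclength_param_imp_john_curve[OF \<gamma>(1,4) _ c(2) _ \<gamma>(5)]) auto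
    moreover have "0 \<le> l" using \<gamma> by (simp add: arclength_param_def)
    ultimately show ?thesis using \<gamma> by (intro exI[of _ "\<lambda>t. \<gamma> (min t l)"]) auto
  qed
  with c const show ?thesis using that by blast
qed

lemma john_curve_ball_subset:
  assumes \<eta>: "john_curve s c T \<Omega> \<eta>" and "1 \<le> s" "0 < c" and t: "0 < t" "t \<le> T" "\<tau> \<in> {t / 2..t}"
  shows "ball (\<eta> \<tau>) (c * (t / 2) powr s) \<subseteq> \<Omega> \<inter> ball (\<eta> 0) ((1 + c * T powr (s - 1)) * t)"
proof (intro Int_greatest)
  have "c * (t / 2) powr s \<le> c * \<tau> powr s" using assms by (intro mult_left_mono powr_mono2) auto
  then have "ball (\<eta> \<tau>) (c * (t / 2) powr s) \<subseteq> ball (\<eta> \<tau>) (c * \<tau> powr s)" by (rule subset_ball)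
  also have "\<dots> \<subseteq> \<Omega>" using \<eta> t by (auto simp: john_curve_def)
  finally show "ball (\<eta> \<tau>) (c * (t / 2) powr s) \<subseteq> \<Omega>" .
  have "dist (\<eta> 0) (\<eta> \<tau>) \<le> 1 * dist 0 \<tau>"
    using \<eta> t unfolding john_curve_def by (intro lipschitz_onD[of 1 "{0..T}"]) auto
  then have "dist (\<eta> 0) (\<eta> \<tau>) \<le> t" using t by (simp add: dist_real_def)
  moreover have "c * (t / 2) powr s \<le> c * (T powr (s - 1) * t)"
  proof (rule mult_left_mono)
    have "(t / 2) powr s \<le> t powr s" using assms by (intro powr_mono2) auto
    also have "\<dots> = t powr (s - 1) * t" using t by (simp add: powr_diff)
    also have "\<dots> \<le> T powr (s - 1) * t" using assms by (intro mult_right_mono powr_mono2) auto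
    finally show "(t / 2) powr s \<le> T powr (s - 1) * t" .
  qed (use \<open>0 < c\<close> in simp)
  ultimately have "dist (\<eta> 0) (\<eta> \<tau>) + c * (t / 2) powr s \<le> (1 + c * T powr (s - 1)) * t"
    by (simp add: algebra_simps)
  then have "dist (\<eta> 0) y < (1 + c * T powr (s - 1)) * t" if "dist (\<eta> \<tau>) y < c * (t / 2) powr s" for y
    using that dist_triangle[of "\<eta> 0" y "\<eta> \<tau>"] by linarith
  then show "ball (\<eta> \<tau>) (c * (t / 2) powr s) \<subseteq> ball (\<eta> 0) ((1 + c * T powr (s - 1)) * t)" by auto
qed

lemma (in C1_gradient) abs_diff_cube_mean_shrink_le:
  defines "n \<equiv> real DIM('a)"
  assumes "0 < r" "1 \<le> k" and "ball w (r * (n + 2)) \<subseteq> \<Omega>"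
  shows "ennreal \<bar>cube_mean u w r - cube_mean u w (r / k)\<bar>
    \<le> ennreal ((n + 1) * r powr (1 - n) * k powr n) * ball_integral grad_norm w (r * (n + 2))"
proof -
  have "r / k \<le> r / 1" using assms by (intro divide_left_mono) auto
  then have "ennreal \<bar>cube_mean u w r - cube_mean u w (r / k)\<bar>
      \<le> ennreal ((n + 1) * r * (r / k) powr - n) * ball_integral grad_norm w (r * (n + 2))"
    unfolding n_def using assms by (intro abs_diff_cube_mean_le_ball_integral) auto
  also have "(n + 1) * r * (r / k) powr - n = (n + 1) * r powr (1 - n) * k powr n"
    using assms by (simp add: powr_divide powr_minus powr_diff field_simps)
  finally show ?thesis .
qed

definition john_radius :: "real \<Rightarrow> real \<Rightarrow> real \<Rightarrow> real \<Rightarrow> real" where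
  "john_radius n s c t = c * (t / 2) powr s / (n + 2)"

definition john_const :: "real \<Rightarrow> real \<Rightarrow> real \<Rightarrow> real \<Rightarrow> real" where
  "john_const n s c D = (n + 1) * (2 * (2 * n + 5) powr n + 2 powr (s * n)) *
     (c / (2 powr s * (n + 2) * D powr s)) powr (1 - n)"

lemma john_radius_pos: "0 < john_radius n s c t" if "0 < n" "0 < c" "0 < t"
  using that by (simp add: john_radius_def)

lemma john_radius_half: "john_radius n s c (t / 2) = john_radius n s c t / 2 powr s"
  unfolding john_radius_def powr_divide[of "t / 2" 2] by simp

lemma john_const_pos: "0 < john_const n s c D" if "0 < n" "0 < c" "0 < D"
  using that unfolding john_const_def by (intro mult_pos_pos add_pos_pos) auto

lemma john_radius_powr:
  assumes "0 < t" "0 < D"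
  shows "(n + 1) * john_radius n s c t powr (1 - n) * (2 * (2 * n + 5) powr n + 2 powr (s * n))
    = john_const n s c D * (D * t) powr (s * (1 - n))"
proof -
  have "john_radius n s c t = c / (2 powr s * (n + 2) * D powr s) * (D * t) powr s"
    using assms by (simp add: john_radius_def powr_divide powr_mult)
  also have "\<dots> powr (1 - n)
      = (c / (2 powr s * (n + 2) * D powr s)) powr (1 - n) * ((D * t) powr s) powr (1 - n)"
    by (rule powr_mult)
  finally show ?thesis by (simp add: john_const_def powr_powr)
qed

lemma (in C1_gradient) abs_diff_cube_mean_john_step_le:
  fixes s c T t :: real and \<eta> :: "real \<Rightarrow> 'a"
  defines "n \<equiv> real DIM('a)"
  defines "\<rho> \<equiv> john_radius n s c" and "D \<equiv> 1 + c * T powr (s - 1)"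
  assumes \<eta>: "john_curve s c T \<Omega> \<eta>" and "1 \<le> s" "0 < c" "0 < t" "t \<le> T"
  shows "ennreal \<bar>cube_mean u (\<eta> t) (\<rho> t) - cube_mean u (\<eta> (t / 2)) (\<rho> (t / 2))\<bar>
    \<le> ennreal (john_const n s c D * (D * t) powr (s * (1 - n))) * ball_integral grad_norm (\<eta> 0) (D * t)"
proof -
  define J where "J = ball_integral grad_norm (\<eta> 0) (D * t)"
  define mid where "mid = cube_mean u (\<eta> (t / 2)) (\<rho> t)"
  have n: "0 < n" by (simp add: n_def)
  have r: "0 < \<rho> t" unfolding \<rho>_def using n assms by (intro john_radius_pos)
  have "\<rho> t * (n + 2) = c * (t / 2) powr s" using n by (simp add: \<rho>_def john_radius_def)
  then have sub: "ball (\<eta> \<tau>) (\<rho> t * (n + 2)) \<subseteq> \<Omega> \<inter> ball (\<eta> 0) (D * t)" if "\<tau> \<in> {t / 2..t}" for \<tau>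
    using john_curve_ball_subset[OF \<eta>, of t \<tau>] assms that by (simp only: D_def)
  have lip: "1-lipschitz_on {t / 2..t} \<eta>"
    using \<eta> \<open>t \<le> T\<close> \<open>0 < t\<close> unfolding john_curve_def by (auto intro: lipschitz_on_subset)
  define moved where "moved = \<bar>mid - cube_mean u (\<eta> t) (\<rho> t)\<bar>"
  define shrunk where "shrunk = \<bar>mid - cube_mean u (\<eta> (t / 2)) (\<rho> (t / 2))\<bar>"
  have moved: "ennreal moved \<le> ennreal ((n + 1) * \<rho> t powr (1 - n) * (2 * (2 * n + 5) powr n)) * J"
    unfolding moved_def mid_def J_def n_def using lip r sub \<open>0 < t\<close>
    by (intro abs_diff_cube_mean_along_curve_le) (auto simp: n_def)
  have "1 \<le> (2::real) powr s" using \<open>1 \<le> s\<close> by (intro ge_one_powr_ge_zero) auto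
  then have "ennreal shrunk \<le> ennreal ((n + 1) * \<rho> t powr (1 - n) * 2 powr (s * n)) *
      ball_integral grad_norm (\<eta> (t / 2)) (\<rho> t * (n + 2))"
    using abs_diff_cube_mean_shrink_le[of "\<rho> t" "2 powr s" "\<eta> (t / 2)"] r sub[of "t / 2"] \<open>0 < t\<close>
    by (simp add: shrunk_def mid_def n_def \<rho>_def john_radius_half powr_powr)
  also have "\<dots> \<le> ennreal ((n + 1) * \<rho> t powr (1 - n) * 2 powr (s * n)) * J"
    unfolding J_def using sub[of "t / 2"] \<open>0 < t\<close> by (intro mult_left_mono nn_set_integral_set_mono) auto
  finally have shrunk: "ennreal shrunk \<le> ennreal ((n + 1) * \<rho> t powr (1 - n) * 2 powr (s * n)) * J" .
  have "ennreal \<bar>cube_mean u (\<eta> t) (\<rho> t) - cube_mean u (\<eta> (t / 2)) (\<rho> (t / 2))\<bar> \<le> ennreal (moved + shrunk)"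
    unfolding moved_def shrunk_def by (intro ennreal_leI) linarith
  also have "\<dots> = ennreal moved + ennreal shrunk" by (simp add: moved_def shrunk_def)
  also have "\<dots> \<le> ennreal ((n + 1) * \<rho> t powr (1 - n) * (2 * (2 * n + 5) powr n)) * J
      + ennreal ((n + 1) * \<rho> t powr (1 - n) * 2 powr (s * n)) * J"
    by (rule add_mono[OF moved shrunk])
  also have "\<dots> = ennreal ((n + 1) * \<rho> t powr (1 - n) * (2 * (2 * n + 5) powr n + 2 powr (s * n))) * J"
    using n by (simp add: distrib_left ennreal_plus distrib_right)
  also have "(n + 1) * \<rho> t powr (1 - n) * (2 * (2 * n + 5) powr n + 2 powr (s * n))
      = john_const n s c D * (D * t) powr (s * (1 - n))"
    unfolding \<rho>_def D_def using assms by (intro john_radius_powr) (auto intro: add_pos_nonneg)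
  finally show ?thesis by (simp add: J_def)
qed

lemma (in C1_gradient) tendsto_cube_mean_along_john_curve:
  assumes \<eta>: "john_curve s c T \<Omega> \<eta>" and "0 < T" "\<eta> 0 \<in> \<Omega>" "0 < s"
  shows "(\<lambda>j. cube_mean u (\<eta> (T / 2 ^ j)) (john_radius n s c (T / 2 ^ j))) \<longlonglongrightarrow> u (\<eta> 0)"
proof (rule tendsto_cube_mean[OF continuous_on_domain open_domain \<open>\<eta> 0 \<in> \<Omega>\<close>])
  have t0: "(\<lambda>j. T / 2 ^ j) \<longlonglongrightarrow> 0"
    by (rule LIMSEQ_divide_realpow_zero) simp
  have "T / 2 ^ j \<in> {0..T}" for j
    using \<open>0 < T\<close> divide_left_mono[of 1 "2 ^ j" T] by simp
  then show "(\<lambda>j. \<eta> (T / 2 ^ j)) \<longlonglongrightarrow> \<eta> 0"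
    using \<eta> \<open>0 < T\<close> unfolding john_curve_def
    by (intro continuous_on_tendsto_compose[OF lipschitz_on_continuous_on t0]) auto
  have "(\<lambda>j. c * (T / 2 ^ j / 2) powr s * (1 / (n + 2))) \<longlonglongrightarrow> c * (0 / 2) powr s * (1 / (n + 2))"
    using t0 \<open>0 < T\<close> \<open>0 < s\<close>
    by (intro tendsto_intros tendsto_powr2) (auto intro!: always_eventually)
  then show "(\<lambda>j. john_radius n s c (T / 2 ^ j)) \<longlonglongrightarrow> 0" by (simp add: john_radius_def)
qed

lemma (in C1_gradient) abs_diff_cube_mean_le_dyadic_riesz_potential:
  fixes s c T :: real and \<eta> :: "real \<Rightarrow> 'a"
  defines "n \<equiv> real DIM('a)"
  defines "\<rho> \<equiv> john_radius n s c" and "D \<equiv> 1 + c * T powr (s - 1)"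
  assumes \<eta>: "john_curve s c T \<Omega> \<eta>" and pos: "1 \<le> s" "0 < c" "0 < T" and "\<eta> 0 \<in> \<Omega>"
  shows "ennreal \<bar>u (\<eta> 0) - cube_mean u (\<eta> T) (\<rho> T)\<bar>
    \<le> ennreal (john_const n s c D) * dyadic_riesz_potential (n + s * (1 - n)) (D * T) grad_norm (\<eta> 0)"
proof -
  define K where "K = john_const n s c D"
  define t where "t = (\<lambda>j::nat. T / 2 ^ j)"
  define U where "U = (\<lambda>j. cube_mean u (\<eta> (t j)) (\<rho> (t j)))"
  define J where "J = (\<lambda>j. ball_integral grad_norm (\<eta> 0) (D * T / 2 ^ j))"
  have D: "0 < D" using pos by (simp add: D_def add_pos_nonneg)
  have K: "0 < K" unfolding K_def using pos D by (intro john_const_pos) (auto simp: n_def)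
  have t: "0 < t j" "t j \<le> T" "t (Suc j) = t j / 2" for j
    using pos divide_left_mono[of 1 "2 ^ j" T] by (auto simp: t_def)
  have step: "ennreal (dist (U j) (U (Suc j)))
      \<le> ennreal K * (ennreal ((D * T / 2 ^ j) powr (s * (1 - n))) * J j)" for j
  proof -
    have "ennreal (dist (U j) (U (Suc j)))
        \<le> ennreal (K * (D * t j) powr (s * (1 - n))) * ball_integral grad_norm (\<eta> 0) (D * t j)"
      unfolding U_def t(3) dist_real_def K_def \<rho>_def n_def D_def
      by (rule abs_diff_cube_mean_john_step_le[OF \<eta> pos(1,2) t(1,2)])
    also have "\<dots> = ennreal K * (ennreal ((D * T / 2 ^ j) powr (s * (1 - n))) * J j)"
      using K by (simp add: t_def J_def ennreal_mult mult.assoc)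
    finally show ?thesis .
  qed
  have "U \<longlonglongrightarrow> u (\<eta> 0)"
    using tendsto_cube_mean_along_john_curve[OF \<eta> \<open>0 < T\<close> \<open>\<eta> 0 \<in> \<Omega>\<close>, of n] pos
    by (simp add: U_def t_def \<rho>_def)
  then have "ennreal (dist (U 0) (u (\<eta> 0))) \<le> (\<Sum>j. ennreal (dist (U j) (U (Suc j))))"
    by (rule dist_lim_le_suminf_dist)
  also have "\<dots> \<le> (\<Sum>j. ennreal K * (ennreal ((D * T / 2 ^ j) powr (s * (1 - n))) * J j))"
    by (intro suminf_le step) auto
  also have "\<dots> = ennreal K * dyadic_riesz_potential (n + s * (1 - n)) (D * T) grad_norm (\<eta> 0)"
    by (simp add: dyadic_riesz_potential_def n_def J_def)
  finally show ?thesis by (simp add: U_def t_def dist_real_def abs_minus_commute K_def)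
qed

lemma s_john_domain_pointwise_estimate:
  fixes \<Omega> :: "'a::euclidean_space set"
  defines "n \<equiv> real DIM('a)"
  assumes john: "s_john_domain s \<Omega>"
  obtains C R :: real where "0 < C" "0 < R"
    "\<And>u g. C1_gradient \<Omega> u g \<Longrightarrow> \<exists>b. \<forall>x\<in>\<Omega>. ennreal \<bar>u x - b\<bar>
      \<le> ennreal C * dyadic_riesz_potential (n + s * (1 - n)) R (C1_gradient.grad_norm \<Omega> g) x"
proof -
  have s: "1 \<le> s" using john by (simp add: s_john_domain_def)
  obtain c T :: real and x0 where cT: "0 < c" "0 < T"
    and curves: "\<And>x. x \<in> \<Omega> \<Longrightarrow> \<exists>\<eta>. john_curve s c T \<Omega> \<eta> \<and> \<eta> 0 = x \<and> \<eta> T = x0"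
    using s_john_domain_obtain_curves[OF john] by blast
  define D where "D = 1 + c * T powr (s - 1)"
  have D: "0 < D" using cT by (simp add: D_def add_pos_nonneg)
  have "\<exists>b. \<forall>x\<in>\<Omega>. ennreal \<bar>u x - b\<bar> \<le> ennreal (john_const n s c D) *
      dyadic_riesz_potential (n + s * (1 - n)) (D * T) (C1_gradient.grad_norm \<Omega> g) x"
    if "C1_gradient \<Omega> u g" for u g
  proof (intro exI ballI)
    fix x assume "x \<in> \<Omega>"
    with curves obtain \<eta> where \<eta>: "john_curve s c T \<Omega> \<eta>" "\<eta> 0 = x" "\<eta> T = x0" by blast
    show "ennreal \<bar>u x - cube_mean u x0 (john_radius n s c T)\<bar> \<le> ennreal (john_const n s c D) *
        dyadic_riesz_potential (n + s * (1 - n)) (D * T) (C1_gradient.grad_norm \<Omega> g) x"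
      using C1_gradient.abs_diff_cube_mean_le_dyadic_riesz_potential[OF that \<eta>(1) s cT] \<eta> \<open>x \<in> \<Omega>\<close>
      by (simp add: D_def n_def)
  qed
  moreover have "0 < john_const n s c D" using cT D by (intro john_const_pos) (auto simp: n_def)
  moreover have "0 < D * T" using D cT by simp
  ultimately show ?thesis using that by blast
qed

subsection \<open>Countable sums\<close>

lemma nn_integral_count_space_le_of_unique_support:
  assumes unique: "\<And>i j. i \<in> A \<Longrightarrow> j \<in> A \<Longrightarrow> F i \<noteq> 0 \<Longrightarrow> F j \<noteq> 0 \<Longrightarrow> i = j"
    and bound: "\<And>i. i \<in> A \<Longrightarrow> F i \<le> c"
  shows "(\<integral>\<^sup>+i. F i \<partial>count_space A) \<le> c"
proof (cases "\<exists>i\<in>A. F i \<noteq> 0")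
  case True
  then obtain i where i: "i \<in> A" "F i \<noteq> 0" by blast
  then have "(\<integral>\<^sup>+i. F i \<partial>count_space A) = (\<integral>\<^sup>+i. F i \<partial>count_space {i})"
    using unique by (intro nn_integral_count_space_eq) auto
  also have "\<dots> \<le> c" using bound[OF i(1)] by (simp add: nn_integral_count_space_finite)
  finally show ?thesis .
next
  case False
  then have "(\<integral>\<^sup>+i. F i \<partial>count_space A) = (\<integral>\<^sup>+i. 0 \<partial>count_space A)" by (intro nn_integral_cong) auto
  then show ?thesis by simp
qed

lemma finite_of_weighted_sum_le:
  assumes sum: "(\<integral>\<^sup>+i. ennreal (w i) * F i \<partial>count_space A) \<le> ennreal S" and "i \<in> A" "0 < w i"
  shows "F i < \<infinity>"
proof -
  have "ennreal (w i) * F i \<le> ennreal S"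
    using nn_integral_ge_point[OF \<open>i \<in> A\<close>] sum by (rule order_trans)
  then have "ennreal (w i) * F i < \<infinity>" by (rule le_less_trans) simp
  then show ?thesis
    using \<open>0 < w i\<close> by (auto simp: ennreal_mult_less_top ennreal_mult_eq_top_iff less_top)
qed

lemma nn_integral_count_space_Sigma:
  "(\<integral>\<^sup>+(i, j). F i j \<partial>count_space (Sigma A B)) = (\<integral>\<^sup>+i. (\<integral>\<^sup>+j. F i j \<partial>count_space (B i)) \<partial>count_space A)"
proof -
  have "(\<integral>\<^sup>+(i, j). F i j \<partial>count_space (Sigma A B))
      = (\<integral>\<^sup>+q. (case q of (i, j) \<Rightarrow> F i j) * indicator (Sigma A B) q \<partial>count_space UNIV)"
    by (simp add: nn_integral_count_space_indicator)
  also have "\<dots> = (\<integral>\<^sup>+i. (\<integral>\<^sup>+j. F i j * indicator (B i) j * indicator A i \<partial>count_space UNIV) \<partial>count_space UNIV)"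
    by (subst nn_integral_fst_count_space[symmetric]) (auto intro!: nn_integral_cong split: split_indicator)
  also have "\<dots> = (\<integral>\<^sup>+i. (\<integral>\<^sup>+j. F i j \<partial>count_space (B i)) \<partial>count_space A)"
    by (simp add: nn_integral_count_space_indicator nn_integral_multc)
  finally show ?thesis .
qed

lemma term_le_suminf_ennreal:
  fixes F :: "nat \<Rightarrow> ennreal"
  shows "F i \<le> (\<Sum>i. F i)"
  using sum_le_suminf[of F "{i}"] by simp

lemma suminf_ennreal_geometric:
  fixes q :: real
  assumes "0 \<le> q" "q < 1"
  shows "(\<Sum>i. ennreal (q ^ i)) = ennreal (1 / (1 - q))"
  using assms by (intro suminf_ennreal_eq geometric_sums) auto

lemma nn_integral_range_geometric_le:
  fixes h :: "nat \<Rightarrow> int" and \<mu> y :: real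
  assumes "0 < \<mu>" "inj h" and far: "\<And>i. real i \<le> \<bar>real_of_int (h i) - y\<bar>"
  shows "(\<integral>\<^sup>+k\<in>range h. ennreal (2 powr (- \<mu> * \<bar>real_of_int k - y\<bar>)) \<partial>count_space UNIV)
    \<le> ennreal (1 / (1 - 2 powr - \<mu>))"
proof -
  define q :: real where "q = 2 powr - \<mu>"
  have q: "0 < q" "q < 1" using assms by (auto simp: q_def powr_less_one)
  define F where "F = (\<lambda>k::int. ennreal (2 powr (- \<mu> * \<bar>real_of_int k - y\<bar>)))"
  have "(\<integral>\<^sup>+k\<in>range h. F k \<partial>count_space UNIV) = (\<Sum>i. F (h i))"
    using nn_integral_count_compose_inj[OF \<open>inj h\<close>, of F] by (simp add: nn_integral_count_space_nat)
  also have "\<dots> \<le> (\<Sum>i. ennreal (q ^ i))"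
  proof (intro suminf_le ennreal_leI)
    fix i
    have "- \<mu> * \<bar>real_of_int (h i) - y\<bar> \<le> - \<mu> * real i" using far[of i] \<open>0 < \<mu>\<close> by simp
    then have "2 powr (- \<mu> * \<bar>real_of_int (h i) - y\<bar>) \<le> 2 powr (- \<mu> * real i)" by (intro powr_mono) auto
    also have "\<dots> = q ^ i" unfolding powr_powr[symmetric] q_def by (simp add: powr_realpow)
    finally show "F (h i) \<le> ennreal (q ^ i)" by (simp add: F_def ennreal_leI)
  qed auto
  also have "\<dots> = ennreal (1 / (1 - q))" using q by (intro suminf_ennreal_geometric) auto
  finally show ?thesis by (simp add: F_def q_def)
qed

lemma nn_integral_two_sided_geometric_le:
  fixes \<mu> y :: real
  assumes "0 < \<mu>"
  shows "(\<integral>\<^sup>+k. ennreal (2 powr (- \<mu> * \<bar>real_of_int k - y\<bar>)) \<partial>count_space UNIV) \<le> ennreal (2 / (1 - 2 powr - \<mu>))"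
proof -
  define F where "F = (\<lambda>k::int. ennreal (2 powr (- \<mu> * \<bar>real_of_int k - y\<bar>)))"
  define below where "below = (\<lambda>i::nat. \<lfloor>y\<rfloor> - int i)"
  define above where "above = (\<lambda>i::nat. \<lfloor>y\<rfloor> + 1 + int i)"
  have "k = below (nat (\<lfloor>y\<rfloor> - k)) \<or> k = above (nat (k - \<lfloor>y\<rfloor> - 1))" for k
    by (auto simp: below_def above_def)
  then have "range below \<union> range above = UNIV" by blast
  then have "(\<integral>\<^sup>+k. F k \<partial>count_space UNIV) = (\<integral>\<^sup>+k\<in>range below \<union> range above. F k \<partial>count_space UNIV)"
    by simp
  also have "\<dots> = (\<integral>\<^sup>+k\<in>range below. F k \<partial>count_space UNIV) + (\<integral>\<^sup>+k\<in>range above. F k \<partial>count_space UNIV)"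
    by (rule nn_integral_disjoint_pair_countspace) (auto simp: below_def above_def)
  also have "\<dots> \<le> ennreal (1 / (1 - 2 powr - \<mu>)) + ennreal (1 / (1 - 2 powr - \<mu>))"
    unfolding F_def
  proof (intro add_mono nn_integral_range_geometric_le assms)
    show "real i \<le> \<bar>real_of_int (below i) - y\<bar>" "real i \<le> \<bar>real_of_int (above i) - y\<bar>" for i
      using of_int_floor_le[of y] real_of_int_floor_add_one_gt[of y] by (simp add: below_def above_def; linarith)+
  qed (auto simp: below_def above_def inj_def)
  also have "\<dots> = ennreal (2 / (1 - 2 powr - \<mu>))"
    using powr_less_one[of 2 "- \<mu>"] assms by (subst ennreal_plus[symmetric]) auto
  finally show ?thesis by (simp add: F_def)
qed

lemma suminf_two_sided_geometric_le:
  fixes \<mu> y :: real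
  assumes "0 < \<mu>"
  shows "(\<Sum>j. ennreal (2 powr (- \<mu> * \<bar>real j - y\<bar>))) \<le> ennreal (2 / (1 - 2 powr - \<mu>))"
proof -
  define F where "F = (\<lambda>k::int. ennreal (2 powr (- \<mu> * \<bar>real_of_int k - y\<bar>)))"
  have "(\<Sum>j. F (int j)) = (\<integral>\<^sup>+k\<in>range int. F k \<partial>count_space UNIV)"
    using nn_integral_count_compose_inj[of int UNIV F] by (simp add: nn_integral_count_space_nat)
  also have "\<dots> \<le> (\<integral>\<^sup>+k\<in>UNIV. F k \<partial>count_space UNIV)"
    by (rule nn_set_integral_set_mono) simp
  also have "\<dots> \<le> ennreal (2 / (1 - 2 powr - \<mu>))"
    using nn_integral_two_sided_geometric_le[OF assms, of y] by (simp add: F_def)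
  finally show ?thesis by (simp add: F_def)
qed

abbreviation dyadic_sum :: "real \<Rightarrow> (int \<Rightarrow> ennreal) \<Rightarrow> ennreal" where
  "dyadic_sum p F \<equiv> \<integral>\<^sup>+k. ennreal (2 powr (real_of_int k * p)) * F k \<partial>count_space UNIV"

subsection \<open>Hausdorff content and Choquet integrals\<close>

lemma hausdorff_content_mono: "A \<subseteq> B \<Longrightarrow> hausdorff_content \<beta> A \<le> hausdorff_content \<beta> B"
  unfolding hausdorff_content_def by (rule INF_superset_mono) auto

lemma hausdorff_content_le_countable_cover:
  assumes I: "countable I" and nonneg: "\<And>i. i \<in> I \<Longrightarrow> 0 \<le> \<rho> i" and cover: "E \<subseteq> (\<Union>i\<in>I. ball (y i) (\<rho> i))"
  shows "hausdorff_content \<beta> E \<le> (\<integral>\<^sup>+i. ennreal (\<rho> i powr \<beta>) \<partial>count_space I)"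
proof -
  define T where "T = to_nat_on I ` I"
  define x where "x = (\<lambda>k. y (from_nat_into I k))"
  define r where "r = (\<lambda>k. if k \<in> T then \<rho> (from_nat_into I k) else 0)"
  have inverse: "from_nat_into I (to_nat_on I i) = i" if "i \<in> I" for i
    using I that by simp
  have "hausdorff_content \<beta> E \<le> (\<Sum>k. ennreal (r k powr \<beta>))"
    unfolding hausdorff_content_def
  proof (rule INF_lower2[of "(x, r)"])
    have "E \<subseteq> (\<Union>k. ball (x k) (r k))"
    proof
      fix e assume "e \<in> E"
      then obtain i where "i \<in> I" "e \<in> ball (y i) (\<rho> i)" using cover by blast
      then have "e \<in> ball (x (to_nat_on I i)) (r (to_nat_on I i))" by (auto simp: x_def r_def T_def inverse)
      then show "e \<in> (\<Union>k. ball (x k) (r k))" by blast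
    qed
    then show "(x, r) \<in> {(x, r). (\<forall>i. 0 \<le> r i) \<and> E \<subseteq> (\<Union>i. ball (x i) (r i))}"
      using nonneg by (auto simp: r_def T_def inverse)
  qed simp
  also have "\<dots> = (\<integral>\<^sup>+k. ennreal (r k powr \<beta>) \<partial>count_space UNIV)"
    by (simp add: nn_integral_count_space_nat)
  also have "\<dots> = (\<integral>\<^sup>+k. ennreal (\<rho> (from_nat_into I k) powr \<beta>) \<partial>count_space T)"
    by (subst nn_integral_count_space_indicator)
      (auto intro!: nn_integral_cong simp: r_def split: split_indicator)
  also have "\<dots> = (\<integral>\<^sup>+i. ennreal (\<rho> (from_nat_into I (to_nat_on I i)) powr \<beta>) \<partial>count_space I)"
    unfolding T_def using I
    by (intro nn_integral_bij_count_space[symmetric]) (auto simp: bij_betw_def inj_on_to_nat_on)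
  also have "\<dots> = (\<integral>\<^sup>+i. ennreal (\<rho> i powr \<beta>) \<partial>count_space I)"
    by (intro nn_integral_cong) (simp add: inverse)
  finally show ?thesis .
qed

definition cover_content :: "real \<Rightarrow> (nat \<Rightarrow> real) \<Rightarrow> ennreal" where
  "cover_content \<delta> \<rho> = (\<Sum>j. ennreal (\<rho> j powr \<delta>))"

lemma obtain_cover_of_hausdorff_content_less:
  assumes "hausdorff_content \<beta> E < c"
  obtains x \<rho> where "\<And>j. 0 \<le> \<rho> j" "E \<subseteq> (\<Union>j. ball (x j) (\<rho> j))" "cover_content \<beta> \<rho> < c"
  using assms unfolding hausdorff_content_def cover_content_def INF_less_iff by auto

lemma emeasure_lborel_le_hausdorff_content_powr:
  fixes E :: "'a::euclidean_space set"
  defines "n \<equiv> real DIM('a)"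
  assumes \<delta>: "0 < \<delta>" "\<delta> \<le> n" and less: "hausdorff_content \<delta> E < ennreal \<tau>"
  shows "emeasure lborel E \<le> ennreal (unit_ball_vol n * \<tau> powr (n / \<delta>))"
proof -
  have \<tau>: "0 < \<tau>" using le_less_trans[OF zero_le less] by simp
  obtain x \<rho> where \<rho>: "\<And>j. 0 \<le> \<rho> j" and cover: "E \<subseteq> (\<Union>j. ball (x j) (\<rho> j))" and "cover_content \<delta> \<rho> < ennreal \<tau>"
    by (rule obtain_cover_of_hausdorff_content_less[OF less]) blast
  then have sum: "(\<Sum>j. ennreal (\<rho> j powr \<delta>)) < ennreal \<tau>" by (simp add: cover_content_def)
  define \<omega> where "\<omega> = unit_ball_vol n"
  have \<omega>: "0 \<le> \<omega>" by (simp add: \<omega>_def n_def)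
  have volume_le: "emeasure lborel (ball (x j) (\<rho> j))
      \<le> ennreal (\<omega> * \<tau> powr (n / \<delta> - 1)) * ennreal (\<rho> j powr \<delta>)" for j
  proof (cases "\<rho> j = 0")
    case False
    then have pos: "0 < \<rho> j" using \<rho>[of j] by simp
    have "\<rho> j powr \<delta> \<le> \<tau>" using ennreal_suminf_lessD[OF sum, of j] \<tau> by (simp add: ennreal_less_iff)
    then have "(\<rho> j powr \<delta>) powr (n / \<delta> - 1) \<le> \<tau> powr (n / \<delta> - 1)" using \<delta> by (intro powr_mono2) auto
    then have "\<omega> * \<rho> j powr \<delta> * (\<rho> j powr \<delta>) powr (n / \<delta> - 1) \<le> \<omega> * \<rho> j powr \<delta> * \<tau> powr (n / \<delta> - 1)"
      using \<omega> by (intro mult_left_mono) auto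
    moreover have "\<rho> j ^ DIM('a) = \<rho> j powr \<delta> * (\<rho> j powr \<delta>) powr (n / \<delta> - 1)"
      using pos \<delta> by (simp add: powr_powr powr_add[symmetric] powr_realpow[symmetric] algebra_simps n_def)
    ultimately show ?thesis
      using pos \<omega> by (simp add: emeasure_ball \<omega>_def n_def ennreal_mult[symmetric] ennreal_leI mult_ac)
  qed simp
  have "emeasure lborel E \<le> emeasure lborel (\<Union>j. ball (x j) (\<rho> j))"
    using cover by (rule emeasure_mono) auto
  also have "\<dots> \<le> (\<Sum>j. emeasure lborel (ball (x j) (\<rho> j)))"
    by (intro emeasure_subadditive_countably) auto
  also have "\<dots> \<le> (\<Sum>j. ennreal (\<omega> * \<tau> powr (n / \<delta> - 1)) * ennreal (\<rho> j powr \<delta>))"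
    by (intro suminf_le volume_le) auto
  also have "\<dots> \<le> ennreal (\<omega> * \<tau> powr (n / \<delta> - 1)) * ennreal \<tau>"
    using sum by (simp add: mult_left_mono less_imp_le)
  also have "\<dots> = ennreal (\<omega> * \<tau> powr (n / \<delta>))"
    using \<tau> \<omega> by (simp add: ennreal_mult[symmetric] powr_diff)
  finally show ?thesis by (simp add: \<omega>_def)
qed

lemma obtain_cover_of_hausdorff_content_finite:
  assumes "hausdorff_content \<beta> E < \<infinity>" "0 < \<epsilon>"
  obtains x \<rho> where "\<And>j. 0 \<le> \<rho> j" "E \<subseteq> (\<Union>j. ball (x j) (\<rho> j))"
    "cover_content \<beta> \<rho> < hausdorff_content \<beta> E + ennreal \<epsilon>"
proof -
  have "hausdorff_content \<beta> E < hausdorff_content \<beta> E + ennreal \<epsilon>"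
    using assms by (cases "hausdorff_content \<beta> E")
      (auto simp: ennreal_plus[symmetric] ennreal_less_iff simp del: ennreal_plus)
  then show ?thesis by (rule obtain_cover_of_hausdorff_content_less) (rule that)
qed

definition dyadic_interval :: "real \<Rightarrow> int \<Rightarrow> real set" where
  "dyadic_interval p k = {2 powr ((real_of_int k - 1) * p)<..2 powr (real_of_int k * p)}"

lemma dyadic_interval_unique:
  assumes "0 < p" "t \<in> dyadic_interval p k" "t \<in> dyadic_interval p l"
  shows "k = l"
proof -
  have "2 powr ((real_of_int k - 1) * p) < 2 powr (real_of_int l * p)"
    "2 powr ((real_of_int l - 1) * p) < 2 powr (real_of_int k * p)"
    using assms unfolding dyadic_interval_def greaterThanAtMost_iff by (blast intro: less_le_trans)+
  then show ?thesis using \<open>0 < p\<close> by simp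
qed

lemma dyadic_interval_measurable [measurable]: "dyadic_interval p k \<in> sets borel"
  by (simp add: dyadic_interval_def)

lemma emeasure_dyadic_interval:
  assumes "0 < p"
  shows "emeasure lborel (dyadic_interval p k) = ennreal ((1 - 2 powr - p) * 2 powr (real_of_int k * p))"
proof -
  have "2 powr ((real_of_int k - 1) * p) \<le> 2 powr (real_of_int k * p)"
    using assms by (intro powr_mono) (auto simp: algebra_simps)
  then show ?thesis by (simp add: dyadic_interval_def algebra_simps powr_diff powr_minus field_simps)
qed

lemma dyadic_sum_le_choquet_integral:
  fixes \<Omega> :: "'a::metric_space set" and f :: "'a \<Rightarrow> real"
  assumes "0 < p"
  shows "ennreal (1 - 2 powr - p) * dyadic_sum p (\<lambda>k. hausdorff_content \<beta> {x\<in>\<Omega>. f x > 2 powr real_of_int k})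
    \<le> choquet_integral \<beta> \<Omega> (\<lambda>x. f x powr p)"
proof -
  define H where "H = (\<lambda>k::int. hausdorff_content \<beta> {x\<in>\<Omega>. f x > 2 powr real_of_int k})"
  have "0 \<le> 1 - 2 powr - p" using assms powr_mono[of "-p" 0 "2::real"] by simp
  then have "ennreal (1 - 2 powr - p) * dyadic_sum p H
      = (\<integral>\<^sup>+k. H k * emeasure lborel (dyadic_interval p k) \<partial>count_space UNIV)"
    using assms by (simp add: emeasure_dyadic_interval ennreal_mult nn_integral_cmult[symmetric] mult_ac)
  also have "\<dots> = (\<integral>\<^sup>+k. (\<integral>\<^sup>+t. H k * indicator (dyadic_interval p k) t \<partial>lborel) \<partial>count_space UNIV)"
    by (intro nn_integral_cong nn_integral_cmult_indicator[symmetric]) simp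
  also have "\<dots> = (\<integral>\<^sup>+t. (\<integral>\<^sup>+k. H k * indicator (dyadic_interval p k) t \<partial>count_space UNIV) \<partial>lborel)"
    by (rule nn_integral_count_space_nn_integral[symmetric]) auto
  also have "\<dots> \<le> choquet_integral \<beta> \<Omega> (\<lambda>x. f x powr p)"
    unfolding choquet_integral_def
  proof (intro nn_integral_mono nn_integral_count_space_le_of_unique_support)
    fix t :: real and k :: int
    show "H k * indicator (dyadic_interval p k) t
      \<le> indicator {0<..} t * hausdorff_content \<beta> {x \<in> \<Omega>. t < f x powr p}"
    proof (cases "t \<in> dyadic_interval p k")
      case True
      then have t: "2 powr ((real_of_int k - 1) * p) < t" "t \<le> (2 powr real_of_int k) powr p"
        by (simp_all add: dyadic_interval_def powr_powr)
      have "H k \<le> hausdorff_content \<beta> {x \<in> \<Omega>. t < f x powr p}"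
        unfolding H_def
      proof (intro hausdorff_content_mono Collect_mono impI conjI)
        fix x assume "x \<in> \<Omega> \<and> 2 powr real_of_int k < f x"
        then show "t < f x powr p"
          using \<open>0 < p\<close> by (intro le_less_trans[OF t(2)] powr_less_mono2) auto
      qed auto
      moreover have "0 < t" using t(1) by (rule less_trans[rotated]) simp
      ultimately show ?thesis using True by simp
    qed simp
  qed (auto simp: indicator_def intro: dyadic_interval_unique[OF assms] split: if_splits)
  finally show ?thesis by (simp add: H_def)
qed

lemma obtain_almost_optimal_covers:
  fixes E :: "int \<Rightarrow> 'a::metric_space set" and w :: "int \<Rightarrow> real"
  assumes w: "\<And>k. 0 < w k" and "0 \<le> S" "0 < \<epsilon>"
    and sum: "(\<integral>\<^sup>+k. ennreal (w k) * hausdorff_content \<delta> (E k) \<partial>count_space UNIV) \<le> ennreal S"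
  obtains x \<rho> where "\<And>k j. 0 \<le> \<rho> k j" "\<And>k. E k \<subseteq> (\<Union>j. ball (x k j) (\<rho> k j))"
    "(\<integral>\<^sup>+k. ennreal (w k) * cover_content \<delta> (\<rho> k) \<partial>count_space UNIV) \<le> ennreal (S + 4 * \<epsilon>)"
proof -
  define G where "G = (\<lambda>k::int. 2 powr (- 1 * \<bar>real_of_int k - 0\<bar>) :: real)"
  have "\<exists>x \<rho>. (\<forall>j. 0 \<le> \<rho> j) \<and> E k \<subseteq> (\<Union>j. ball (x j) (\<rho> j)) \<and>
      cover_content \<delta> \<rho> < hausdorff_content \<delta> (E k) + ennreal (\<epsilon> / w k * G k)" for k
  proof -
    have "hausdorff_content \<delta> (E k) < \<infinity>"
      by (rule finite_of_weighted_sum_le[OF sum UNIV_I w])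
    moreover have "0 < \<epsilon> / w k * G k" using w[of k] \<open>0 < \<epsilon>\<close> by (simp add: G_def)
    ultimately show ?thesis by (rule obtain_cover_of_hausdorff_content_finite) blast
  qed
  then obtain x \<rho> where \<rho>: "\<And>k j. 0 \<le> \<rho> k j" "\<And>k. E k \<subseteq> (\<Union>j. ball (x k j) (\<rho> k j))"
    and near: "\<And>k. cover_content \<delta> (\<rho> k) < hausdorff_content \<delta> (E k) + ennreal (\<epsilon> / w k * G k)"
    by metis
  have "(\<integral>\<^sup>+k. ennreal (w k) * cover_content \<delta> (\<rho> k) \<partial>count_space UNIV)
      \<le> (\<integral>\<^sup>+k. ennreal (w k) * hausdorff_content \<delta> (E k) + ennreal \<epsilon> * ennreal (G k) \<partial>count_space UNIV)"
  proof (intro nn_integral_mono)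
    fix k
    have "ennreal (w k) * cover_content \<delta> (\<rho> k)
        \<le> ennreal (w k) * (hausdorff_content \<delta> (E k) + ennreal (\<epsilon> / w k * G k))"
      using near[of k] by (intro mult_left_mono) (auto intro: less_imp_le)
    also have "\<dots> = ennreal (w k) * hausdorff_content \<delta> (E k) + ennreal (w k * (\<epsilon> / w k * G k))"
      using w[of k] \<open>0 < \<epsilon>\<close> by (simp add: distrib_left ennreal_mult[symmetric] G_def)
    also have "w k * (\<epsilon> / w k * G k) = \<epsilon> * G k" using w[of k] by simp
    also have "ennreal \<dots> = ennreal \<epsilon> * ennreal (G k)"
      using \<open>0 < \<epsilon>\<close> by (intro ennreal_mult) (auto simp: G_def)
    finally show "ennreal (w k) * cover_content \<delta> (\<rho> k)
        \<le> ennreal (w k) * hausdorff_content \<delta> (E k) + ennreal \<epsilon> * ennreal (G k)" .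
  qed
  also have "\<dots> = (\<integral>\<^sup>+k. ennreal (w k) * hausdorff_content \<delta> (E k) \<partial>count_space UNIV)
      + ennreal \<epsilon> * (\<integral>\<^sup>+k. ennreal (G k) \<partial>count_space UNIV)"
    by (subst nn_integral_add) (auto simp: nn_integral_cmult)
  also have "\<dots> \<le> ennreal S + ennreal \<epsilon> * ennreal (2 / (1 - 2 powr - 1))"
    unfolding G_def by (intro add_mono mult_left_mono sum nn_integral_two_sided_geometric_le) auto
  also have "2 / (1 - 2 powr - 1) = (4::real)" by (simp add: powr_minus)
  also have "ennreal \<epsilon> * ennreal 4 = ennreal (4 * \<epsilon>)"
    using \<open>0 < \<epsilon>\<close> by (simp only: ennreal_mult mult.commute)
  also have "ennreal S + \<dots> = ennreal (S + 4 * \<epsilon>)" using \<open>0 \<le> S\<close> \<open>0 < \<epsilon>\<close> by simp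
  finally show ?thesis using that \<rho> by blast
qed

definition dyadic_cover :: "('a::metric_space \<Rightarrow> real) \<Rightarrow> (int \<Rightarrow> nat \<Rightarrow> 'a) \<Rightarrow> (int \<Rightarrow> nat \<Rightarrow> real) \<Rightarrow> bool" where
  "dyadic_cover f x \<rho> \<longleftrightarrow> (\<forall>k j. 0 \<le> \<rho> k j) \<and>
     (\<forall>k. {y. f y > 2 powr real_of_int k} \<subseteq> (\<Union>j. ball (x k j) (\<rho> k j)))"

lemma obtain_dyadic_cover:
  fixes f :: "'a::metric_space \<Rightarrow> real"
  assumes "0 < p" and less: "choquet_integral \<delta> UNIV (\<lambda>x. f x powr p) < ennreal G"
  obtains x \<rho> where "dyadic_cover f x \<rho>"
    "dyadic_sum p (\<lambda>k. cover_content \<delta> (\<rho> k)) \<le> ennreal ((1 / (1 - 2 powr - p) + 4) * G)"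
proof -
  define c where "c = 1 - 2 powr - p"
  have c: "0 < c" using assms powr_less_mono[of "-p" 0 "2::real"] by (simp add: c_def)
  have G: "0 < G" using le_less_trans[OF zero_le less] by simp
  define H where "H = dyadic_sum p (\<lambda>k. hausdorff_content \<delta> {x. f x > 2 powr real_of_int k})"
  have "ennreal c * H \<le> ennreal G"
    using dyadic_sum_le_choquet_integral[OF \<open>0 < p\<close>, of \<delta> UNIV f] less unfolding c_def H_def by simp
  then have "ennreal (1 / c) * (ennreal c * H) \<le> ennreal (1 / c) * ennreal G"
    by (rule mult_left_mono) simp
  then have "H \<le> ennreal (1 / c * G)"
    using c G by (simp add: mult.assoc[symmetric] ennreal_mult[symmetric])
  then obtain x \<rho> where "\<And>k j. 0 \<le> \<rho> k j"
    "\<And>k. {x. f x > 2 powr real_of_int k} \<subseteq> (\<Union>j. ball (x k j) (\<rho> k j))"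
    "dyadic_sum p (\<lambda>k. cover_content \<delta> (\<rho> k)) \<le> ennreal (1 / c * G + 4 * G)"
    unfolding H_def
    by (rule obtain_almost_optimal_covers[where \<epsilon> = G, rotated 3]) (use c G in auto)
  then show ?thesis
    by (intro that[of x \<rho>]) (simp_all add: dyadic_cover_def c_def distrib_right)
qed

lemma ennreal_le_sum_dyadic_layers:
  fixes t :: real and m :: int
  shows "ennreal t \<le> ennreal (2 powr m) +
    (\<Sum>i. ennreal (2 powr (real_of_int (m + int i) + 1)) * indicator {i. 2 powr real_of_int (m + int i) < t} i)"
proof (cases "2 powr m < t")
  case False
  then show ?thesis by (intro add_increasing2 ennreal_leI) auto
next
  case True
  then have pos: "0 < t" using less_trans[of 0 "2 powr m" t] by simp
  define k where "k = \<lceil>log 2 t\<rceil> - 1"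
  have "real_of_int m < log 2 t" using True pos by (simp add: less_log_iff)
  then have "m \<le> k" unfolding k_def by linarith
  then obtain i where i: "k = m + int i" using zle_iff_zadd by blast
  have "real_of_int k < log 2 t" "log 2 t \<le> real_of_int k + 1" unfolding k_def by linarith+
  then have "2 powr real_of_int k < t" "t \<le> 2 powr (real_of_int k + 1)"
    using pos by (simp_all add: less_log_iff log_le_iff)
  then have "ennreal t \<le> ennreal (2 powr (real_of_int (m + int i) + 1)) *
      indicator {i. 2 powr real_of_int (m + int i) < t} i"
    by (auto simp: i intro: ennreal_leI)
  also have "\<dots> \<le> (\<Sum>i. ennreal (2 powr (real_of_int (m + int i) + 1)) *
      indicator {i. 2 powr real_of_int (m + int i) < t} i)"
    by (rule term_le_suminf_ennreal)
  finally show ?thesis by (simp add: add_increasing)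
qed

lemma nn_integral_le_dyadic_layers:
  fixes f :: "'a \<Rightarrow> real" and m :: int
  assumes [measurable]: "f \<in> borel_measurable M" "B \<in> sets M"
  shows "(\<integral>\<^sup>+y\<in>B. ennreal (f y) \<partial>M) \<le> ennreal (2 powr m) * emeasure M B +
    (\<Sum>i. ennreal (2 powr (real_of_int (m + int i) + 1)) * emeasure M {y\<in>B. f y > 2 powr real_of_int (m + int i)})"
proof -
  define E where "E = (\<lambda>i. {y\<in>B. f y > 2 powr real_of_int (m + int i)})"
  have [measurable]: "E i \<in> sets M" for i
  proof -
    have "E i = B \<inter> {y\<in>space M. f y > 2 powr real_of_int (m + int i)}"
      using sets.sets_into_space[of B M] assms by (auto simp: E_def)
    then show ?thesis by simp
  qed
  have "(\<integral>\<^sup>+y\<in>B. ennreal (f y) \<partial>M) \<le> (\<integral>\<^sup>+y. ennreal (2 powr m) * indicator B y +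
      (\<Sum>i. ennreal (2 powr (real_of_int (m + int i) + 1)) * indicator (E i) y) \<partial>M)"
  proof (intro nn_integral_mono)
    fix y
    show "ennreal (f y) * indicator B y \<le> ennreal (2 powr m) * indicator B y +
      (\<Sum>i. ennreal (2 powr (real_of_int (m + int i) + 1)) * indicator (E i) y)"
      using ennreal_le_sum_dyadic_layers[of "f y" m] by (cases "y \<in> B") (simp_all add: E_def indicator_def)
  qed
  also have "\<dots> = ennreal (2 powr m) * emeasure M B +
      (\<Sum>i. ennreal (2 powr (real_of_int (m + int i) + 1)) * emeasure M (E i))"
    by (subst nn_integral_add) (auto simp: nn_integral_suminf nn_integral_cmult)
  finally show ?thesis by (simp add: E_def)
qed

definition decay_const :: "real \<Rightarrow> real \<Rightarrow> real \<Rightarrow> real" where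
  "decay_const n \<delta> p0 = unit_ball_vol n * (1 + 2 / (1 - 2 powr (1 - p0 * n / \<delta>)))"

lemma decay_ratio_less_one:
  fixes n \<delta> p0 :: real
  assumes "0 < n" "0 < \<delta>" "\<delta> / n < p0"
  shows "2 powr (1 - p0 * n / \<delta>) < (1::real)"
  using assms by (intro powr_less_one) (auto simp: field_simps)

lemma decay_const_pos:
  assumes "0 < n" "0 < \<delta>" "\<delta> / n < p0"
  shows "0 < decay_const n \<delta> p0"
  using assms decay_ratio_less_one[OF assms] unfolding decay_const_def
  by (intro mult_pos_pos add_pos_pos unit_ball_vol_pos) auto

lemma emeasure_dyadic_layer_le:
  fixes E :: "'a::euclidean_space set" and m :: int and i :: nat and p0 \<delta> :: real
  defines "n \<equiv> real DIM('a)"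
  defines "q \<equiv> 2 powr (1 - p0 * n / \<delta>)"
  assumes \<delta>: "0 < \<delta>" "\<delta> \<le> n" and r: "0 < r"
    and content: "hausdorff_content \<delta> E < ennreal (2 powr (- (real i * p0)) * r powr \<delta>)"
  shows "ennreal (2 powr (real_of_int (m + int i) + 1)) * emeasure lborel E
    \<le> ennreal (2 * 2 powr m * (unit_ball_vol n * r ^ DIM('a)) * q ^ i)"
proof -
  define V where "V = unit_ball_vol n * r ^ DIM('a)"
  have V: "0 \<le> V" using r by (simp add: V_def n_def)
  have "emeasure lborel E \<le> ennreal (unit_ball_vol n * (2 powr (- (real i * p0)) * r powr \<delta>) powr (n / \<delta>))"
    unfolding n_def using \<delta> content by (intro emeasure_lborel_le_hausdorff_content_powr) (auto simp: n_def)
  also have "(2 powr (- (real i * p0)) * r powr \<delta>) powr (n / \<delta>) = 2 powr (- (real i * (p0 * n / \<delta>))) * r ^ DIM('a)"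
    using \<delta> r by (simp add: powr_mult powr_powr n_def powr_realpow mult.assoc)
  finally have "ennreal (2 powr (real_of_int (m + int i) + 1)) * emeasure lborel E
      \<le> ennreal (2 powr (real_of_int (m + int i) + 1)) * ennreal (2 powr (- (real i * (p0 * n / \<delta>))) * V)"
    by (intro mult_left_mono) (auto simp: V_def mult_ac)
  also have "\<dots> = ennreal (2 powr (real_of_int (m + int i) + 1) * 2 powr (- (real i * (p0 * n / \<delta>))) * V)"
    using V by (simp add: ennreal_mult[symmetric])
  also have "2 powr (real_of_int (m + int i) + 1) * 2 powr (- (real i * (p0 * n / \<delta>))) = 2 * 2 powr m * q ^ i"
  proof -
    have "2 powr real i * 2 powr (- (real i * (p0 * n / \<delta>))) = q powr real i"
      unfolding q_def powr_add[symmetric] powr_powr by (simp add: algebra_simps)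
    moreover have "2 powr (real_of_int (m + int i) + 1) = 2 * 2 powr m * 2 powr real i" by (simp add: powr_add)
    moreover have "0 < q" by (simp add: q_def)
    ultimately show ?thesis by (simp add: powr_realpow mult.assoc)
  qed
  finally show ?thesis by (simp add: V_def mult_ac)
qed

lemma ball_integral_le_of_content_decay:
  fixes f :: "'a::euclidean_space \<Rightarrow> real" and m :: int
  defines "n \<equiv> real DIM('a)"
  assumes \<delta>: "0 < \<delta>" "\<delta> \<le> n" and p0: "\<delta> / n < p0"
    and [measurable]: "f \<in> borel_measurable borel" and r: "0 < r"
    and decay: "\<And>i::nat. hausdorff_content \<delta> {y\<in>ball z r. f y > 2 powr real_of_int (m + int i)}
      < ennreal (2 powr (- (real i * p0)) * r powr \<delta>)"
  shows "ball_integral f z r \<le> ennreal (decay_const n \<delta> p0 * 2 powr m * r ^ DIM('a))"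
proof -
  define V where "V = unit_ball_vol n * r ^ DIM('a)"
  have V: "0 \<le> V" using r by (simp add: V_def n_def)
  define q where "q = 2 powr (1 - p0 * n / \<delta>)"
  have q: "0 < q" "q < 1" using decay_ratio_less_one[OF _ \<delta>(1) p0] by (auto simp: q_def n_def)
  have "ball_integral f z r \<le> ennreal (2 powr m) * emeasure lborel (ball z r) +
    (\<Sum>i. ennreal (2 powr (real_of_int (m + int i) + 1)) *
      emeasure lborel {y\<in>ball z r. f y > 2 powr real_of_int (m + int i)})"
    by (rule nn_integral_le_dyadic_layers) auto
  also have "\<dots> \<le> ennreal (2 powr m) * ennreal V + (\<Sum>i. ennreal (2 * 2 powr m * V * q ^ i))"
    using \<delta> r decay unfolding V_def q_def n_def
    by (intro add_mono suminf_le emeasure_dyadic_layer_le) (auto simp: emeasure_ball)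
  also have "(\<Sum>i. ennreal (2 * 2 powr m * V * q ^ i)) = ennreal (2 * 2 powr m * V) * ennreal (1 / (1 - q))"
    using V q by (subst suminf_ennreal_geometric[symmetric]) (auto simp: ennreal_mult)
  also have "ennreal (2 powr m) * ennreal V + \<dots> = ennreal (2 powr m * V + 2 * 2 powr m * V * (1 / (1 - q)))"
    using q V by (simp add: ennreal_mult[symmetric] ennreal_plus[symmetric] del: ennreal_plus)
  also have "2 powr m * V + 2 * 2 powr m * V * (1 / (1 - q)) = decay_const n \<delta> p0 * 2 powr m * r ^ DIM('a)"
    by (simp add: V_def decay_const_def q_def algebra_simps)
  finally show ?thesis .
qed

subsection \<open>A family of balls dominating all averages\<close>

abbreviation triple_ball :: "'a::metric_space \<times> real \<Rightarrow> 'a set" where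
  "triple_ball v \<equiv> cball (fst v) (3 * snd v)"

abbreviation radius_sum :: "real \<Rightarrow> ('a \<times> real) set \<Rightarrow> ennreal" where
  "radius_sum \<delta> V \<equiv> \<integral>\<^sup>+v. ennreal (snd v powr \<delta>) \<partial>count_space V"

definition touching_content :: "real \<Rightarrow> (nat \<Rightarrow> 'a::metric_space) \<Rightarrow> (nat \<Rightarrow> real) \<Rightarrow> 'a \<Rightarrow> real \<Rightarrow> ennreal" where
  "touching_content \<delta> x \<rho> z r =
     (\<integral>\<^sup>+j\<in>{j. ball (x j) (\<rho> j) \<inter> ball z r \<noteq> {} \<and> \<rho> j \<le> r}. ennreal (\<rho> j powr \<delta>) \<partial>count_space UNIV)"

definition tail_content :: "real \<Rightarrow> real \<Rightarrow> (int \<Rightarrow> nat \<Rightarrow> real) \<Rightarrow> int \<Rightarrow> ennreal" where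
  "tail_content p0 \<delta> \<rho> m =
     (\<integral>\<^sup>+k\<in>{m..}. ennreal (2 powr (real_of_int (k - m) * p0)) * cover_content \<delta> (\<rho> k) \<partial>count_space UNIV)"

definition dense_balls ::
  "real \<Rightarrow> real \<Rightarrow> (int \<Rightarrow> nat \<Rightarrow> 'a::metric_space) \<Rightarrow> (int \<Rightarrow> nat \<Rightarrow> real) \<Rightarrow> int \<Rightarrow> ('a \<times> real) set" where
  "dense_balls p0 \<delta> x \<rho> m = {(z, r). 0 < r \<and> (\<exists>k\<ge>m. ennreal (r powr \<delta>)
     \<le> ennreal (2 powr (real_of_int (k - m) * p0)) * touching_content \<delta> (x k) (\<rho> k) z r)}"

lemma touching_content_le_cover_content: "touching_content \<delta> x \<rho> z r \<le> cover_content \<delta> \<rho>"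
proof -
  have "touching_content \<delta> x \<rho> z r \<le> (\<integral>\<^sup>+j\<in>UNIV. ennreal (\<rho> j powr \<delta>) \<partial>count_space UNIV)"
    unfolding touching_content_def by (rule nn_set_integral_set_mono) simp
  then show ?thesis by (simp add: cover_content_def nn_integral_count_space_nat)
qed

lemma radius_powr_le_tail_content:
  assumes "(z, r) \<in> dense_balls p0 \<delta> x \<rho> m"
  shows "ennreal (r powr \<delta>) \<le> tail_content p0 \<delta> \<rho> m"
proof -
  from assms obtain k where "m \<le> k"
    and "ennreal (r powr \<delta>) \<le> ennreal (2 powr (real_of_int (k - m) * p0)) * touching_content \<delta> (x k) (\<rho> k) z r"
    by (auto simp: dense_balls_def)
  note this(2)
  also have "\<dots> \<le> ennreal (2 powr (real_of_int (k - m) * p0)) * cover_content \<delta> (\<rho> k)"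
    by (intro mult_left_mono touching_content_le_cover_content) simp
  also have "\<dots> \<le> tail_content p0 \<delta> \<rho> m"
    using nn_integral_ge_point[of k UNIV
        "\<lambda>k. ennreal (2 powr (real_of_int (k - m) * p0)) * cover_content \<delta> (\<rho> k) * indicator {m..} k"] \<open>m \<le> k\<close>
    by (simp add: tail_content_def)
  finally show ?thesis .
qed

lemma covering_ball_mem_dense_balls:
  assumes "m \<le> k" "0 < \<rho> k j" "0 \<le> p0"
  shows "(x k j, \<rho> k j) \<in> dense_balls p0 \<delta> x \<rho> m"
proof -
  have "ennreal (\<rho> k j powr \<delta>) \<le> touching_content \<delta> (x k) (\<rho> k) (x k j) (\<rho> k j)"
    using nn_integral_ge_point[of j UNIV "\<lambda>i. ennreal (\<rho> k i powr \<delta>) *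
        indicator {i. ball (x k i) (\<rho> k i) \<inter> ball (x k j) (\<rho> k j) \<noteq> {} \<and> \<rho> k i \<le> \<rho> k j} i"] \<open>0 < \<rho> k j\<close>
    by (auto simp: touching_content_def)
  also have "\<dots> \<le> ennreal (2 powr (real_of_int (k - m) * p0)) * touching_content \<delta> (x k) (\<rho> k) (x k j) (\<rho> k j)"
    using assms mult_right_mono[of 1 "ennreal (2 powr (real_of_int (k - m) * p0))"]
    by (simp add: ge_one_powr_ge_zero)
  finally show ?thesis using assms by (auto simp: dense_balls_def)
qed

lemma touching_ball_subset:
  assumes "ball x \<rho> \<inter> ball z r \<noteq> {}" "\<rho> \<le> r"
  shows "ball x \<rho> \<subseteq> cball z (3 * r)"
proof
  obtain w where w: "dist x w < \<rho>" "dist z w < r" using assms(1) by auto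
  fix y assume "y \<in> ball x \<rho>"
  then show "y \<in> cball z (3 * r)"
    using w assms(2) dist_triangle[of z y w] dist_triangle3[of w y x] by simp
qed

lemma sum_touching_content_le:
  assumes disjoint: "pairwise (\<lambda>v w. disjnt (triple_ball v) (triple_ball w)) V"
  shows "(\<integral>\<^sup>+v. touching_content \<delta> x \<rho> (fst v) (snd v) \<partial>count_space V) \<le> cover_content \<delta> \<rho>"
proof -
  define touch where "touch = (\<lambda>v. {j. ball (x j) (\<rho> j) \<inter> ball (fst v) (snd v) \<noteq> {} \<and> \<rho> j \<le> snd v})"
  have unique: "v = w" if "v \<in> V" "w \<in> V" "j \<in> touch v" "j \<in> touch w" for v w j
  proof (rule ccontr)
    assume "v \<noteq> w"
    with disjoint that have "disjnt (triple_ball v) (triple_ball w)"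
      by (auto simp: pairwise_def)
    moreover have "ball (x j) (\<rho> j) \<subseteq> triple_ball v" "ball (x j) (\<rho> j) \<subseteq> triple_ball w"
      using that by (auto simp: touch_def dest!: touching_ball_subset)
    ultimately have "ball (x j) (\<rho> j) = {}" unfolding disjnt_def by blast
    with \<open>j \<in> touch v\<close> show False by (simp add: touch_def)
  qed
  have "(\<integral>\<^sup>+v. touching_content \<delta> x \<rho> (fst v) (snd v) \<partial>count_space V)
      = (\<integral>\<^sup>+v. (\<Sum>j. ennreal (\<rho> j powr \<delta>) * indicator (touch v) j) \<partial>count_space V)"
    by (simp add: touching_content_def touch_def nn_integral_count_space_nat)
  also have "\<dots> = (\<Sum>j. ennreal (\<rho> j powr \<delta>) * (\<integral>\<^sup>+v. indicator (touch v) j \<partial>count_space V))"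
    by (simp add: nn_integral_suminf nn_integral_cmult)
  also have "\<dots> \<le> (\<Sum>j. ennreal (\<rho> j powr \<delta>) * 1)"
    using unique
    by (intro suminf_le mult_left_mono nn_integral_count_space_le_of_unique_support)
      (auto simp: indicator_def split: if_splits)
  finally show ?thesis by (simp add: cover_content_def)
qed

lemma radius_sum_disjoint_dense_balls_le:
  assumes V: "countable V" "V \<subseteq> dense_balls p0 \<delta> x \<rho> m"
    and disjoint: "pairwise (\<lambda>v w. disjnt (triple_ball v) (triple_ball w)) V"
  shows "radius_sum \<delta> V \<le> tail_content p0 \<delta> \<rho> m"
proof -
  define W where "W = (\<lambda>k. ennreal (2 powr (real_of_int (k - m) * p0)) * indicator {m..} k)"
  define touch where "touch = (\<lambda>k v. touching_content \<delta> (x k) (\<rho> k) (fst v) (snd v))"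
  have "radius_sum \<delta> V \<le> (\<integral>\<^sup>+v. (\<integral>\<^sup>+k. W k * touch k v \<partial>count_space UNIV) \<partial>count_space V)"
  proof (intro nn_integral_mono)
    fix v assume "v \<in> space (count_space V)"
    with V(2) have "(fst v, snd v) \<in> dense_balls p0 \<delta> x \<rho> m" by auto
    then obtain k where "m \<le> k" "ennreal (snd v powr \<delta>)
        \<le> ennreal (2 powr (real_of_int (k - m) * p0)) * touch k v"
      by (auto simp: dense_balls_def touch_def)
    then have "ennreal (snd v powr \<delta>) \<le> W k * touch k v"
      by (simp add: W_def)
    also have "\<dots> \<le> (\<integral>\<^sup>+k. W k * touch k v \<partial>count_space UNIV)"
      by (rule nn_integral_ge_point) simp
    finally show "ennreal (snd v powr \<delta>) \<le> \<dots>" .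
  qed
  also have "\<dots> = (\<integral>\<^sup>+k. (\<integral>\<^sup>+v. W k * touch k v \<partial>count_space V) \<partial>count_space UNIV)"
    using V(1) by (intro nn_integral_count_space_nn_integral[symmetric]) auto
  also have "\<dots> = (\<integral>\<^sup>+k. W k * (\<integral>\<^sup>+v. touch k v \<partial>count_space V) \<partial>count_space UNIV)"
    by (simp add: nn_integral_cmult)
  also have "\<dots> \<le> (\<integral>\<^sup>+k. W k * cover_content \<delta> (\<rho> k) \<partial>count_space UNIV)"
    unfolding touch_def by (intro nn_integral_mono mult_left_mono sum_touching_content_le disjoint) simp
  also have "\<dots> = tail_content p0 \<delta> \<rho> m"
    by (simp add: tail_content_def W_def mult_ac)
  finally show ?thesis .
qed

lemma dyadic_sum_tail_content_le:
  assumes "p0 < p"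
  shows "dyadic_sum p (tail_content p0 \<delta> \<rho>)
    \<le> ennreal (2 / (1 - 2 powr - (p - p0))) * dyadic_sum p (\<lambda>k. cover_content \<delta> (\<rho> k))"
proof -
  define S where "S = (\<lambda>k. ennreal (2 powr (real_of_int k * p)) * cover_content \<delta> (\<rho> k))"
  define W where "W = (\<lambda>m k. ennreal (2 powr (real_of_int m * p)) *
      (ennreal (2 powr (real_of_int (k - m) * p0)) * cover_content \<delta> (\<rho> k) * indicator {m..} k))"
  define D where "D = (\<lambda>m k. ennreal (2 powr (- (p - p0) * \<bar>real_of_int m - real_of_int k\<bar>)))"
  have W_le: "W m k \<le> S k * D m k" for m k
  proof (cases "m \<le> k")
    case True
    then have "2 powr (real_of_int m * p) * 2 powr (real_of_int (k - m) * p0)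
        = 2 powr (real_of_int k * p) * 2 powr (- (p - p0) * \<bar>real_of_int m - real_of_int k\<bar>)"
      by (simp add: powr_add[symmetric] algebra_simps)
    then have "ennreal (2 powr (real_of_int m * p)) * ennreal (2 powr (real_of_int (k - m) * p0))
        = ennreal (2 powr (real_of_int k * p)) * D m k"
      unfolding D_def by (simp only: ennreal_mult[symmetric] powr_ge_zero)
    then show ?thesis using True by (simp add: W_def S_def mult_ac)
  qed (simp add: W_def)
  have "dyadic_sum p (tail_content p0 \<delta> \<rho>) = (\<integral>\<^sup>+m. (\<integral>\<^sup>+k. W m k \<partial>count_space UNIV) \<partial>count_space UNIV)"
    by (simp add: tail_content_def W_def nn_integral_cmult)
  also have "\<dots> = (\<integral>\<^sup>+k. (\<integral>\<^sup>+m. W m k \<partial>count_space UNIV) \<partial>count_space UNIV)"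
    by (rule nn_integral_count_space_nn_integral) auto
  also have "\<dots> \<le> (\<integral>\<^sup>+k. (\<integral>\<^sup>+m. S k * D m k \<partial>count_space UNIV) \<partial>count_space UNIV)"
    by (intro nn_integral_mono W_le)
  also have "\<dots> = (\<integral>\<^sup>+k. S k * (\<integral>\<^sup>+m. D m k \<partial>count_space UNIV) \<partial>count_space UNIV)"
    by (intro nn_integral_cong nn_integral_cmult) auto
  also have "\<dots> \<le> (\<integral>\<^sup>+k. S k * ennreal (2 / (1 - 2 powr - (p - p0))) \<partial>count_space UNIV)"
    unfolding D_def using assms by (intro nn_integral_mono mult_left_mono nn_integral_two_sided_geometric_le) auto
  also have "\<dots> = ennreal (2 / (1 - 2 powr - (p - p0))) * (\<integral>\<^sup>+k. S k \<partial>count_space UNIV)"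
    by (simp add: nn_integral_multc mult.commute)
  finally show ?thesis by (simp add: S_def)
qed

lemma dyadic_cover_subset: "dyadic_cover f x \<rho> \<Longrightarrow> {y. f y > 2 powr real_of_int k} \<subseteq> (\<Union>j. ball (x k j) (\<rho> k j))"
  by (simp add: dyadic_cover_def)

lemma hausdorff_content_superlevel_le_touching_content:
  assumes cover: "dyadic_cover f x \<rho>" and small: "\<And>j. ball (x k j) (\<rho> k j) \<inter> ball z r \<noteq> {} \<Longrightarrow> \<rho> k j \<le> r"
  shows "hausdorff_content \<delta> {y\<in>ball z r. f y > 2 powr real_of_int k} \<le> touching_content \<delta> (x k) (\<rho> k) z r"
proof -
  define M where "M = {j. ball (x k j) (\<rho> k j) \<inter> ball z r \<noteq> {} \<and> \<rho> k j \<le> r}"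
  have "hausdorff_content \<delta> {y\<in>ball z r. f y > 2 powr real_of_int k}
      \<le> (\<integral>\<^sup>+j. ennreal (\<rho> k j powr \<delta>) \<partial>count_space M)"
  proof (rule hausdorff_content_le_countable_cover)
    show "{y\<in>ball z r. f y > 2 powr real_of_int k} \<subseteq> (\<Union>j\<in>M. ball (x k j) (\<rho> k j))"
    proof
      fix y assume y: "y \<in> {y\<in>ball z r. f y > 2 powr real_of_int k}"
      with dyadic_cover_subset[OF cover, of k] obtain j where "y \<in> ball (x k j) (\<rho> k j)" by blast
      with y small show "y \<in> (\<Union>j\<in>M. ball (x k j) (\<rho> k j))" unfolding M_def by blast
    qed
  qed (use cover in \<open>auto simp: dyadic_cover_def\<close>)
  also have "\<dots> = touching_content \<delta> (x k) (\<rho> k) z r"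
    by (simp add: touching_content_def M_def nn_integral_count_space_indicator)
  finally show ?thesis .
qed

text \<open>Every covering ball of a level \<open>k \<ge> m\<close> is itself dense, so a ball to which no dense ball is close
  is touched by smaller covering balls only.\<close>

lemma hausdorff_content_superlevel_less:
  assumes cover: "dyadic_cover f x \<rho>" and "m \<le> k" "0 \<le> p0" "0 < r"
    and no_dense: "\<And>y t. (y, t) \<in> dense_balls p0 \<delta> x \<rho> m \<Longrightarrow> z \<in> ball y (2 * t) \<Longrightarrow> \<not> r \<le> t"
  shows "hausdorff_content \<delta> {y\<in>ball z r. f y > 2 powr real_of_int k}
    < ennreal (2 powr (- (real_of_int (k - m) * p0)) * r powr \<delta>)"
proof -
  have "\<rho> k j \<le> r" if meet: "ball (x k j) (\<rho> k j) \<inter> ball z r \<noteq> {}" for j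
  proof (rule ccontr)
    assume "\<not> \<rho> k j \<le> r"
    then have less: "r < \<rho> k j" by simp
    obtain w where "dist (x k j) w < \<rho> k j" "dist z w < r" using meet by auto
    then have "z \<in> ball (x k j) (2 * \<rho> k j)" using less dist_triangle2[of "x k j" z w] by simp
    then show False
      using no_dense covering_ball_mem_dense_balls[of m k \<rho> j p0] less assms by fastforce
  qed
  then have "hausdorff_content \<delta> {y\<in>ball z r. f y > 2 powr real_of_int k} \<le> touching_content \<delta> (x k) (\<rho> k) z r"
    by (rule hausdorff_content_superlevel_le_touching_content[OF cover])
  also have "\<dots> = ennreal (2 powr (- (real_of_int (k - m) * p0))) *
      (ennreal (2 powr (real_of_int (k - m) * p0)) * touching_content \<delta> (x k) (\<rho> k) z r)"
    by (simp add: mult.assoc[symmetric] ennreal_mult[symmetric] powr_minus)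
  also have "\<dots> < ennreal (2 powr (- (real_of_int (k - m) * p0))) * ennreal (r powr \<delta>)"
  proof (rule ennreal_mult_strict_left_mono)
    have "(z, r) \<notin> dense_balls p0 \<delta> x \<rho> m" using no_dense[of z r] \<open>0 < r\<close> by auto
    then show "ennreal (2 powr (real_of_int (k - m) * p0)) * touching_content \<delta> (x k) (\<rho> k) z r
        < ennreal (r powr \<delta>)"
      using \<open>m \<le> k\<close> \<open>0 < r\<close> by (force simp: dense_balls_def)
  qed auto
  finally show ?thesis by (simp add: ennreal_mult)
qed

text \<open>The factor \<open>15 = 5 * 3\<close> combines the enlargement in Vitali's lemma with that of \<open>triple_ball\<close>.\<close>

definition captures :: "('a::metric_space \<times> real) set \<Rightarrow> 'a \<Rightarrow> real \<Rightarrow> bool" where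
  "captures V z r \<longleftrightarrow> (\<exists>(y, t)\<in>V. z \<in> ball y (15 * t) \<and> r \<le> 15 * t)"

lemma obtain_dense_ball_selection:
  fixes x :: "int \<Rightarrow> nat \<Rightarrow> 'a::euclidean_space"
  assumes "0 < \<delta>" and fin: "tail_content p0 \<delta> \<rho> m < \<infinity>"
  obtains V where "countable V" "V \<subseteq> dense_balls p0 \<delta> x \<rho> m"
    "radius_sum \<delta> V \<le> tail_content p0 \<delta> \<rho> m"
    "\<And>y t z r. (y, t) \<in> dense_balls p0 \<delta> x \<rho> m \<Longrightarrow> z \<in> ball y (2 * t) \<Longrightarrow> r \<le> t \<Longrightarrow> captures V z r"
proof -
  define X where "X = dense_balls p0 \<delta> x \<rho> m"
  define R where "R = enn2real (tail_content p0 \<delta> \<rho> m) powr (1 / \<delta>)"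
  have radius: "0 < 3 * snd v \<and> 3 * snd v \<le> 3 * R" if "v \<in> X" for v
  proof -
    have pos: "0 < snd v" using that by (auto simp: X_def dense_balls_def)
    have "ennreal (snd v powr \<delta>) \<le> tail_content p0 \<delta> \<rho> m"
      using that radius_powr_le_tail_content[of "fst v" "snd v"] by (simp add: X_def)
    then have "snd v powr \<delta> \<le> enn2real (tail_content p0 \<delta> \<rho> m)"
      using fin enn2real_mono by fastforce
    then have "(snd v powr \<delta>) powr (1 / \<delta>) \<le> R" unfolding R_def using \<open>0 < \<delta>\<close> by (intro powr_mono2) auto
    then show ?thesis using pos \<open>0 < \<delta>\<close> by (simp add: powr_powr)
  qed
  obtain V where V: "countable V" "V \<subseteq> X"
    and disjoint: "pairwise (\<lambda>v w. disjnt (triple_ball v) (triple_ball w)) V"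
    and swallow: "\<And>v. v \<in> X \<Longrightarrow> \<exists>w. w \<in> V \<and> \<not> disjnt (triple_ball v) (triple_ball w) \<and>
        triple_ball v \<subseteq> ball (fst w) (5 * (3 * snd w))"
    by (rule Vitali_covering_lemma_cballs_balls[of X "\<lambda>v. 3 * snd v" "3 * R" fst, OF radius])
      (assumption, rule that)
  have "captures V z r" if yt: "(y, t) \<in> X" and z: "z \<in> ball y (2 * t)" and "r \<le> t" for y t z r
  proof -
    obtain w where w: "w \<in> V" "cball y (3 * t) \<subseteq> ball (fst w) (15 * snd w)" using swallow[OF yt] by auto
    have t: "0 < t" using radius[OF yt] by simp
    then have "z \<in> ball (fst w) (15 * snd w)" using w(2) z by fastforce
    moreover have "dist y (fst w) + 3 * t < 15 * snd w"
      using w(2) t unfolding cball_subset_ball_iff by auto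
    then have "r \<le> 15 * snd w" using t \<open>r \<le> t\<close> zero_le_dist[of y "fst w"] by linarith
    ultimately show ?thesis using w(1) by (auto simp: captures_def)
  qed
  then show ?thesis
    using that V radius_sum_disjoint_dense_balls_le[OF V[unfolded X_def] disjoint] unfolding X_def by blast
qed

lemma obtain_level_selection:
  fixes f :: "'a::euclidean_space \<Rightarrow> real"
  defines "n \<equiv> real DIM('a)"
  assumes cover: "dyadic_cover f x \<rho>" and f: "f \<in> borel_measurable borel"
    and \<delta>: "0 < \<delta>" "\<delta> \<le> n" "\<delta> / n < p0" and fin: "tail_content p0 \<delta> \<rho> m < \<infinity>"
  obtains V where "countable V" "\<And>y t. (y, t) \<in> V \<Longrightarrow> 0 < t"
    "radius_sum \<delta> V \<le> tail_content p0 \<delta> \<rho> m"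
    "\<And>z r. 0 < r \<Longrightarrow> \<not> captures V z r \<Longrightarrow> ball_integral f z r
      \<le> ennreal (decay_const n \<delta> p0 * 2 powr real_of_int m * r ^ DIM('a))"
proof -
  obtain V where V: "countable V" "V \<subseteq> dense_balls p0 \<delta> x \<rho> m"
    and sum: "radius_sum \<delta> V \<le> tail_content p0 \<delta> \<rho> m"
    and capture: "\<And>y t z r. (y, t) \<in> dense_balls p0 \<delta> x \<rho> m \<Longrightarrow> z \<in> ball y (2 * t) \<Longrightarrow> r \<le> t \<Longrightarrow> captures V z r"
    using obtain_dense_ball_selection[OF \<delta>(1) fin] by blast
  have "0 \<le> \<delta> / n" using \<delta>(1) by (simp add: n_def)
  then have p0: "0 \<le> p0" using \<delta>(3) by linarith
  have "ball_integral f z r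
      \<le> ennreal (decay_const n \<delta> p0 * 2 powr real_of_int m * r ^ DIM('a))"
    if r: "0 < r" and "\<not> captures V z r" for z r
    unfolding n_def
  proof (rule ball_integral_le_of_content_decay[OF \<delta>(1) _ _ f r])
    fix i
    show "hausdorff_content \<delta> {y\<in>ball z r. f y > 2 powr real_of_int (m + int i)}
        < ennreal (2 powr (- (real i * p0)) * r powr \<delta>)"
      using hausdorff_content_superlevel_less[OF cover _ p0 r, of m "m + int i" \<delta> z] capture that by fastforce
  qed (use \<delta> in \<open>auto simp: n_def\<close>)
  moreover have "0 < t" if "(y, t) \<in> V" for y t using V(2) that by (auto simp: dense_balls_def)
  ultimately show ?thesis using that V(1) sum by blast
qed

definition ball_family :: "(real \<times> 'a::metric_space \<times> real) set \<Rightarrow> bool" where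
  "ball_family I \<longleftrightarrow> countable I \<and> (\<forall>(h, y, t)\<in>I. 0 < h \<and> 0 < t)"

definition weighted_content :: "real \<Rightarrow> real \<Rightarrow> (real \<times> 'a::metric_space \<times> real) set \<Rightarrow> ennreal" where
  "weighted_content p \<delta> I = (\<integral>\<^sup>+(h, y, t). ennreal (h powr p * t powr \<delta>) \<partial>count_space I)"

definition dominates_averages :: "(real \<times> 'a::euclidean_space \<times> real) set \<Rightarrow> ('a \<Rightarrow> real) \<Rightarrow> bool" where
  "dominates_averages I f \<longleftrightarrow> (\<forall>z r. 0 < r \<longrightarrow> ball_integral f z r \<noteq> 0 \<longrightarrow>
     (\<exists>(h, y, t)\<in>I. z \<in> ball y t \<and> r \<le> t \<and> ball_integral f z r \<le> ennreal (h * r ^ DIM('a))))"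

lemma term_le_weighted_content:
  assumes "(h, y, t) \<in> I"
  shows "ennreal (h powr p * t powr \<delta>) \<le> weighted_content p \<delta> I"
  using nn_integral_ge_point[OF assms, of "\<lambda>(h, y, t). ennreal (h powr p * t powr \<delta>)"]
  by (simp add: weighted_content_def)

definition dyadic_family :: "real \<Rightarrow> (int \<Rightarrow> ('a \<times> real) set) \<Rightarrow> (real \<times> 'a \<times> real) set" where
  "dyadic_family A V = (\<lambda>(m, y, t). (A * 2 powr real_of_int m, y, 15 * t)) ` (SIGMA m:UNIV. V m)"

lemma dyadic_familyI: "(y, t) \<in> V m \<Longrightarrow> (A * 2 powr real_of_int m, y, 15 * t) \<in> dyadic_family A V"
  unfolding dyadic_family_def by (rule image_eqI[of _ _ "(m, y, t)"]) auto

lemma ball_family_dyadic_family: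
  assumes "0 < A" "\<And>m. countable (V m)" "\<And>m y t. (y, t) \<in> V m \<Longrightarrow> 0 < t"
  shows "ball_family (dyadic_family A V)"
  using assms by (auto simp: ball_family_def dyadic_family_def)

lemma weighted_content_dyadic_family:
  assumes "0 < A"
  shows "weighted_content p \<delta> (dyadic_family A V) = ennreal (A powr p * 15 powr \<delta>) *
    dyadic_sum p (\<lambda>m. radius_sum \<delta> (V m))"
proof -
  have "inj_on (\<lambda>(m, y, t). (A * 2 powr real_of_int m, y, 15 * t)) (SIGMA m:UNIV. V m)"
    using \<open>0 < A\<close> by (auto simp: inj_on_def powr_inj)
  then have "weighted_content p \<delta> (dyadic_family A V)
      = (\<integral>\<^sup>+(m, v). ennreal ((A * 2 powr real_of_int m) powr p * (15 * snd v) powr \<delta>)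
          \<partial>count_space (SIGMA m:UNIV. V m))"
    unfolding weighted_content_def dyadic_family_def
    by (subst nn_integral_bij_count_space[symmetric, OF inj_on_imp_bij_betw])
      (auto simp: case_prod_beta intro!: nn_integral_cong)
  also have "\<dots> = (\<integral>\<^sup>+m. (\<integral>\<^sup>+v. ennreal (A powr p * 15 powr \<delta>) * (ennreal (2 powr (real_of_int m * p)) *
      ennreal (snd v powr \<delta>)) \<partial>count_space (V m)) \<partial>count_space UNIV)"
    unfolding nn_integral_count_space_Sigma
    by (intro nn_integral_cong) (simp add: powr_mult powr_powr ennreal_mult[symmetric] mult_ac)
  also have "\<dots> = ennreal (A powr p * 15 powr \<delta>) *
    dyadic_sum p (\<lambda>m. radius_sum \<delta> (V m))"
    by (simp add: nn_integral_cmult)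
  finally show ?thesis .
qed

lemma int_last_before_failure:
  fixes a b :: int
  assumes "P a" "\<not> P b" "a \<le> b"
  obtains m where "P m" "\<not> P (m + 1)"
proof (rule ccontr)
  assume "\<not> thesis"
  then have step: "P m \<Longrightarrow> P (m + 1)" for m using that by blast
  from \<open>a \<le> b\<close> have "P b" by (induction rule: int_ge_induct) (use \<open>P a\<close> step in auto)
  with \<open>\<not> P b\<close> show False ..
qed

lemma exists_uncaptured_level:
  assumes "0 < p" "0 < \<delta>" "0 < A" "0 < r" "0 \<le> W" and bound: "weighted_content p \<delta> (dyadic_family A V) \<le> ennreal W"
  shows "\<exists>m. \<not> captures (V m) z r"
proof (rule ccontr)
  assume "\<not> ?thesis"
  then have captured: "captures (V m) z r" for m by blast
  have heights_bounded: "(A * 2 powr real_of_int m) powr p * r powr \<delta> \<le> W" for m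
  proof -
    obtain y t where t: "(y, t) \<in> V m" "r \<le> 15 * t" using captured[of m] by (auto simp: captures_def)
    from order_trans[OF term_le_weighted_content[OF dyadic_familyI[of y t V m A, OF t(1)]] bound]
    have "(A * 2 powr real_of_int m) powr p * (15 * t) powr \<delta> \<le> W"
      using \<open>0 \<le> W\<close> by (subst (asm) ennreal_le_iff) auto
    moreover have "r powr \<delta> \<le> (15 * t) powr \<delta>" using t(2) assms by (intro powr_mono2) auto
    then have "(A * 2 powr real_of_int m) powr p * r powr \<delta> \<le> (A * 2 powr real_of_int m) powr p * (15 * t) powr \<delta>"
      by (intro mult_left_mono) auto
    ultimately show ?thesis by simp
  qed
  define B where "B = W / (A powr p * r powr \<delta>)"
  obtain N :: nat where N: "B < (2 powr p) ^ N"
    using real_arch_pow[of "2 powr p" B] \<open>0 < p\<close> powr_less_mono[of 0 p "2::real"] by auto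
  have "W = (A powr p * r powr \<delta>) * B" using assms by (simp add: B_def)
  also have "\<dots> < (A powr p * r powr \<delta>) * (2 powr p) ^ N"
    using N assms by (intro mult_strict_left_mono) auto
  also have "\<dots> = (A * 2 powr real_of_int (int N)) powr p * r powr \<delta>"
    using \<open>0 < A\<close> by (simp add: powr_mult powr_powr powr_realpow[symmetric] mult_ac)
  finally show False using heights_bounded[of "int N"] by linarith
qed

lemma exists_captured_level:
  fixes f :: "'a::euclidean_space \<Rightarrow> real"
  assumes "0 < K" "0 < r" and nonzero: "ball_integral f z r \<noteq> 0" and b: "\<not> captures (V b) z r"
    and uncaptured: "\<And>m. \<not> captures (V m) z r \<Longrightarrow>
      ball_integral f z r \<le> ennreal (K * 2 powr real_of_int m * r ^ DIM('a))"
  shows "\<exists>a\<le>b. captures (V a) z r"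
proof -
  from uncaptured[OF b] obtain j where j: "ball_integral f z r = ennreal j" "0 < j"
    using nonzero by (cases "ball_integral f z r") (auto simp: less_le top_unique)
  obtain N :: nat where N: "(1/2) ^ N < j / (K * 2 powr b * r ^ DIM('a))"
    using real_arch_pow_inv[of "j / (K * 2 powr b * r ^ DIM('a))" "1/2"] j assms by auto
  have "captures (V (b - int N)) z r"
  proof (rule ccontr)
    assume "\<not> ?thesis"
    from uncaptured[OF this] j have "j \<le> K * 2 powr real_of_int (b - int N) * r ^ DIM('a)"
      using assms by (simp add: ennreal_le_iff)
    also have "\<dots> = (1/2) ^ N * (K * 2 powr b * r ^ DIM('a))"
      by (simp add: powr_diff powr_realpow power_divide)
    also have "\<dots> < j" using N assms by (simp add: pos_less_divide_eq)
    finally show False by simp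
  qed
  then show ?thesis by (intro exI[of _ "b - int N"]) auto
qed

lemma dominates_averages_dyadic_family:
  fixes f :: "'a::euclidean_space \<Rightarrow> real"
  assumes pos: "0 < p" "0 < \<delta>" "0 < K" "0 \<le> W"
    and bound: "weighted_content p \<delta> (dyadic_family (2 * K) V) \<le> ennreal W"
    and uncaptured: "\<And>m z r. 0 < r \<Longrightarrow> \<not> captures (V m) z r \<Longrightarrow>
      ball_integral f z r \<le> ennreal (K * 2 powr real_of_int m * r ^ DIM('a))"
  shows "dominates_averages (dyadic_family (2 * K) V) f"
  unfolding dominates_averages_def
proof (intro allI impI)
  fix z :: 'a and r :: real
  assume r: "0 < r" and nonzero: "ball_integral f z r \<noteq> 0"
  obtain b where b: "\<not> captures (V b) z r"
    using exists_uncaptured_level[OF pos(1,2) _ r pos(4) bound] \<open>0 < K\<close> by auto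
  obtain a where "a \<le> b" "captures (V a) z r"
    using exists_captured_level[OF \<open>0 < K\<close> r nonzero, of V b] b uncaptured[OF r] by blast
  then obtain m where m: "captures (V m) z r" "\<not> captures (V (m + 1)) z r"
    using int_last_before_failure[of "\<lambda>m. captures (V m) z r" a b] b by auto
  obtain y t where t: "(y, t) \<in> V m" "z \<in> ball y (15 * t)" "r \<le> 15 * t"
    using m(1) by (auto simp: captures_def)
  have "ball_integral f z r \<le> ennreal (2 * K * 2 powr real_of_int m * r ^ DIM('a))"
    using uncaptured[OF r m(2)] by (simp add: powr_add mult_ac)
  with t dyadic_familyI[of y t V m "2 * K"]
  show "\<exists>(h, y, t)\<in>dyadic_family (2 * K) V. z \<in> ball y t \<and> r \<le> t \<and>
      ball_integral f z r \<le> ennreal (h * r ^ DIM('a))"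
    by blast
qed

lemma obtain_dominating_dyadic_family:
  fixes f :: "'a::euclidean_space \<Rightarrow> real"
  defines "n \<equiv> real DIM('a)"
  assumes cover: "dyadic_cover f x \<rho>" and f: "f \<in> borel_measurable borel"
    and \<delta>: "0 < \<delta>" "\<delta> \<le> n" "\<delta> / n < p0" and "0 < p" "0 \<le> S"
    and tails: "dyadic_sum p (tail_content p0 \<delta> \<rho>) \<le> ennreal S"
  obtains I where "ball_family I" "dominates_averages I f"
    "weighted_content p \<delta> I \<le> ennreal ((2 * decay_const n \<delta> p0) powr p * 15 powr \<delta> * S)"
proof -
  define K where "K = decay_const n \<delta> p0"
  have K: "0 < K" unfolding K_def using \<delta> by (intro decay_const_pos) (auto simp: n_def)
  have "tail_content p0 \<delta> \<rho> m < \<infinity>" for m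
    by (rule finite_of_weighted_sum_le[OF tails]) auto
  note level_selection = obtain_level_selection[OF cover f \<delta>[unfolded n_def] this]
  define selection where "selection = (\<lambda>m V. countable V \<and> (\<forall>y t. (y, t) \<in> V \<longrightarrow> 0 < t) \<and>
      radius_sum \<delta> V \<le> tail_content p0 \<delta> \<rho> m \<and>
      (\<forall>z r. 0 < r \<longrightarrow> \<not> captures V z r \<longrightarrow>
        ball_integral f z r \<le> ennreal (K * 2 powr real_of_int m * r ^ DIM('a))))"
  have "\<exists>V. selection m V" for m
    unfolding selection_def K_def n_def by (rule level_selection[of m]) blast+
  then obtain V where V: "\<And>m. selection m (V m)" by metis
  have "weighted_content p \<delta> (dyadic_family (2 * K) V) \<le> ennreal ((2 * K) powr p * 15 powr \<delta>) *
      dyadic_sum p (tail_content p0 \<delta> \<rho>)"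
    using K by (subst weighted_content_dyadic_family)
      (use V in \<open>auto simp: selection_def intro!: mult_left_mono nn_integral_mono\<close>)
  also have "\<dots> \<le> ennreal ((2 * K) powr p * 15 powr \<delta>) * ennreal S"
    by (intro mult_left_mono tails) simp
  also have "\<dots> = ennreal ((2 * K) powr p * 15 powr \<delta> * S)"
    using \<open>0 \<le> S\<close> by (simp add: ennreal_mult)
  finally have bound: "weighted_content p \<delta> (dyadic_family (2 * K) V) \<le> ennreal ((2 * K) powr p * 15 powr \<delta> * S)" .
  moreover have "dominates_averages (dyadic_family (2 * K) V) f"
    using \<open>0 \<le> S\<close> V
    by (intro dominates_averages_dyadic_family[OF \<open>0 < p\<close> \<delta>(1) K _ bound]) (auto simp: selection_def)
  moreover have "ball_family (dyadic_family (2 * K) V)"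
    using K V by (intro ball_family_dyadic_family) (auto simp: selection_def)
  ultimately show ?thesis using that by (simp add: K_def)
qed

lemma obtain_dominating_ball_family:
  fixes \<delta> p :: real
  defines "n \<equiv> real DIM('a::euclidean_space)"
  assumes \<delta>: "0 < \<delta>" "\<delta> \<le> n" and p: "\<delta> / n < p"
  obtains C :: real where "0 < C"
    "\<And>(f :: 'a \<Rightarrow> real) G. f \<in> borel_measurable borel \<Longrightarrow> choquet_integral \<delta> UNIV (\<lambda>x. f x powr p) < ennreal G \<Longrightarrow>
      \<exists>I. ball_family I \<and> dominates_averages I f \<and> weighted_content p \<delta> I \<le> ennreal (C * G)"
proof -
  have n: "0 < n" by (simp add: n_def)
  then have "0 < \<delta> / n" using \<delta> by simp
  obtain p0 where p0: "\<delta> / n < p0" "p0 < p" using p dense by blast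
  with \<open>0 < \<delta> / n\<close> have "0 < p" by linarith
  define K where "K = (2 * decay_const n \<delta> p0) powr p * 15 powr \<delta>"
  have K: "0 < K" using decay_const_pos[OF n \<delta>(1) p0(1)] by (simp add: K_def)
  define S where "S = 2 / (1 - 2 powr - (p - p0)) * (1 / (1 - 2 powr - p) + 4)"
  have ratios: "2 powr - (p - p0) < (1::real)" "2 powr - p < (1::real)"
    using p0 \<open>0 < p\<close> by (auto intro: powr_less_one)
  then have S: "0 < S" unfolding S_def by (intro mult_pos_pos add_pos_pos divide_pos_pos) auto
  have "\<exists>I. ball_family I \<and> dominates_averages I f \<and> weighted_content p \<delta> I \<le> ennreal (K * S * G)"
    if f: "f \<in> borel_measurable borel" and less: "choquet_integral \<delta> UNIV (\<lambda>x. f x powr p) < ennreal G"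
    for f :: "'a \<Rightarrow> real" and G
  proof -
    have G: "0 < G" using le_less_trans[OF zero_le less] by simp
    obtain x \<rho> where cover: "dyadic_cover f x \<rho>"
      and sum: "dyadic_sum p (\<lambda>k. cover_content \<delta> (\<rho> k))
        \<le> ennreal ((1 / (1 - 2 powr - p) + 4) * G)"
      using obtain_dyadic_cover[OF \<open>0 < p\<close> less] .
    have "dyadic_sum p (tail_content p0 \<delta> \<rho>)
        \<le> ennreal (2 / (1 - 2 powr - (p - p0))) * ennreal ((1 / (1 - 2 powr - p) + 4) * G)"
      by (rule order_trans[OF dyadic_sum_tail_content_le[OF p0(2)] mult_left_mono[OF sum]]) simp
    also have "\<dots> = ennreal (S * G)"
      using ratios G by (simp add: S_def ennreal_mult[symmetric] mult.assoc)
    finally obtain I where "ball_family I" "dominates_averages I f"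
      "weighted_content p \<delta> I \<le> ennreal (K * (S * G))"
      using S G unfolding K_def n_def
      by (elim obtain_dominating_dyadic_family[OF cover f \<delta>[unfolded n_def] p0(1)[unfolded n_def] \<open>0 < p\<close>, rotated])
        auto
    then show ?thesis by (auto simp: mult.assoc)
  qed
  moreover have "0 < K * S" using K S by simp
  ultimately show ?thesis using that by blast
qed

subsection \<open>The Sobolev inequality for the dyadic Riesz potential\<close>

lemma min_powr_le_powr_abs_log:
  fixes \<alpha> \<gamma> x :: real
  assumes "0 < x"
  shows "min (x powr \<alpha>) (x powr - \<gamma>) \<le> 2 powr (- min \<alpha> \<gamma> * \<bar>log 2 x\<bar>)"
proof -
  define y where "y = log 2 x"
  have x: "x = 2 powr y" using assms by (simp add: y_def)
  show ?thesis
  proof (cases "0 \<le> y")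
    case True
    then have "- \<gamma> * y \<le> - min \<alpha> \<gamma> * \<bar>y\<bar>" by (simp add: mult_right_mono)
    then show ?thesis by (simp add: x powr_powr min.coboundedI2 mult.commute)
  next
    case False
    then have "\<alpha> * y \<le> - min \<alpha> \<gamma> * \<bar>y\<bar>" by (simp add: mult_right_mono_neg)
    then show ?thesis by (simp add: x powr_powr min.coboundedI1 mult.commute)
  qed
qed

lemma min_scaled_powr_le:
  fixes \<alpha> \<gamma> r N K :: real
  assumes exps: "0 < \<alpha>" "0 < \<gamma>" and pos: "0 < r" "0 < N" "0 < K"
  shows "min (N * r powr \<alpha>) (K * r powr - \<gamma>) \<le> N powr (\<gamma> / (\<alpha> + \<gamma>)) * K powr (\<alpha> / (\<alpha> + \<gamma>)) *
    2 powr (- min \<alpha> \<gamma> * \<bar>log 2 (r / (K / N) powr (1 / (\<alpha> + \<gamma>)))\<bar>)"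
proof -
  define \<theta> where "\<theta> = \<alpha> / (\<alpha> + \<gamma>)"
  define L where "L = (K / N) powr (1 / (\<alpha> + \<gamma>))"
  define V where "V = N powr (\<gamma> / (\<alpha> + \<gamma>)) * K powr (\<alpha> / (\<alpha> + \<gamma>))"
  have V: "0 < V" and L: "0 < L" using pos by (simp_all add: V_def L_def)
  have \<theta>: "\<gamma> / (\<alpha> + \<gamma>) = 1 - \<theta>" using exps by (simp add: \<theta>_def field_simps)
  have "L powr \<alpha> = (K / N) powr \<theta>" by (simp add: L_def \<theta>_def powr_powr)
  then have N: "N * L powr \<alpha> = V"
    using pos by (simp add: V_def \<theta> \<theta>_def[symmetric] powr_divide powr_diff)
  have "L powr - \<gamma> = (K / N) powr (\<theta> - 1)" using \<theta> by (simp add: L_def powr_powr)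
  then have K: "K * L powr - \<gamma> = V"
    using pos by (simp add: V_def \<theta> \<theta>_def[symmetric] powr_divide powr_diff)
  have "r = L * (r / L)" using L by simp
  then have "min (N * r powr \<alpha>) (K * r powr - \<gamma>) = min (V * (r / L) powr \<alpha>) (V * (r / L) powr - \<gamma>)"
    by (metis N K mult.assoc powr_mult)
  also have "\<dots> = V * min ((r / L) powr \<alpha>) ((r / L) powr - \<gamma>)"
    using V by (simp add: min_mult_distrib_left)
  also have "\<dots> \<le> V * 2 powr (- min \<alpha> \<gamma> * \<bar>log 2 (r / L)\<bar>)"
    using V L pos by (intro mult_left_mono min_powr_le_powr_abs_log) auto
  finally show ?thesis by (simp add: V_def L_def)
qed

lemma suminf_min_powr_le:
  fixes \<alpha> \<gamma> R N K :: real
  assumes exps: "0 < \<alpha>" "0 < \<gamma>" and pos: "0 < R" "0 < N" "0 < K"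
  shows "(\<Sum>j. ennreal (min (N * (R / 2 ^ j) powr \<alpha>) (K * (R / 2 ^ j) powr - \<gamma>)))
    \<le> ennreal (2 / (1 - 2 powr - min \<alpha> \<gamma>) * (N powr (\<gamma> / (\<alpha> + \<gamma>)) * K powr (\<alpha> / (\<alpha> + \<gamma>))))"
proof -
  define V where "V = N powr (\<gamma> / (\<alpha> + \<gamma>)) * K powr (\<alpha> / (\<alpha> + \<gamma>))"
  define L where "L = (K / N) powr (1 / (\<alpha> + \<gamma>))"
  have V: "0 \<le> V" and L: "0 < L" using pos by (simp_all add: V_def L_def)
  have "log 2 (R / 2 ^ j / L) = log 2 (R / L) - real j" for j
    using L pos by (simp add: log_divide_pos log_mult_pos log_nat_power)
  then have "min (N * (R / 2 ^ j) powr \<alpha>) (K * (R / 2 ^ j) powr - \<gamma>)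
      \<le> V * 2 powr (- min \<alpha> \<gamma> * \<bar>real j - log 2 (R / L)\<bar>)" for j
    using min_scaled_powr_le[OF exps, of "R / 2 ^ j" N K] pos by (simp add: V_def L_def abs_minus_commute)
  then have "(\<Sum>j. ennreal (min (N * (R / 2 ^ j) powr \<alpha>) (K * (R / 2 ^ j) powr - \<gamma>)))
      \<le> (\<Sum>j. ennreal (V * 2 powr (- min \<alpha> \<gamma> * \<bar>real j - log 2 (R / L)\<bar>)))"
    by (intro suminf_le ennreal_leI) auto
  also have "\<dots> = ennreal V * (\<Sum>j. ennreal (2 powr (- min \<alpha> \<gamma> * \<bar>real j - log 2 (R / L)\<bar>)))"
    using V by (simp add: ennreal_mult)
  also have "\<dots> \<le> ennreal V * ennreal (2 / (1 - 2 powr - min \<alpha> \<gamma>))"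
    using exps by (intro mult_left_mono suminf_two_sided_geometric_le) auto
  also have "\<dots> = ennreal (2 / (1 - 2 powr - min \<alpha> \<gamma>) * V)"
    using V powr_less_one[of 2 "- min \<alpha> \<gamma>"] exps
    by (subst ennreal_mult[symmetric]) (auto simp: mult.commute)
  finally show ?thesis by (simp add: V_def)
qed

text \<open>No subadditivity of the Choquet integral is needed here, since only the supremum of the heights of
  the balls containing a point enters.\<close>

lemma choquet_integral_le_sum_of_heights:
  fixes \<Omega> :: "'a::metric_space set" and y :: "'i \<Rightarrow> 'a"
  assumes I: "countable I" and nonneg: "\<And>i. i \<in> I \<Longrightarrow> 0 \<le> r i" "\<And>i. i \<in> I \<Longrightarrow> 0 \<le> w i"
    and height: "\<And>x t. x \<in> \<Omega> \<Longrightarrow> 0 < t \<Longrightarrow> t < f x \<Longrightarrow> \<exists>i\<in>I. x \<in> ball (y i) (r i) \<and> t < w i"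
  shows "choquet_integral \<beta> \<Omega> f \<le> (\<integral>\<^sup>+i. ennreal (r i powr \<beta> * w i) \<partial>count_space I)"
proof -
  have "choquet_integral \<beta> \<Omega> f
      \<le> (\<integral>\<^sup>+t. (\<integral>\<^sup>+i. ennreal (r i powr \<beta>) * indicator {0<..<w i} t \<partial>count_space I) \<partial>lborel)"
    unfolding choquet_integral_def
  proof (intro nn_integral_mono)
    fix t :: real
    show "indicator {0<..} t * hausdorff_content \<beta> {x \<in> \<Omega>. t < f x}
      \<le> (\<integral>\<^sup>+i. ennreal (r i powr \<beta>) * indicator {0<..<w i} t \<partial>count_space I)"
    proof (cases "0 < t")
      case True
      have "hausdorff_content \<beta> {x \<in> \<Omega>. t < f x} \<le> (\<integral>\<^sup>+i. ennreal (r i powr \<beta>) \<partial>count_space {i\<in>I. t < w i})"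
      proof (rule hausdorff_content_le_countable_cover)
        show "{x \<in> \<Omega>. t < f x} \<subseteq> (\<Union>i\<in>{i\<in>I. t < w i}. ball (y i) (r i))"
          using height[OF _ True] by blast
      qed (use I nonneg in auto)
      also have "\<dots> = (\<integral>\<^sup>+i. ennreal (r i powr \<beta>) * indicator {0<..<w i} t \<partial>count_space I)"
        using True by (simp add: nn_integral_count_space_indicator)
          (auto intro!: nn_integral_cong split: split_indicator)
      finally show ?thesis using True by simp
    qed simp
  qed
  also have "\<dots> = (\<integral>\<^sup>+i. (\<integral>\<^sup>+t. ennreal (r i powr \<beta>) * indicator {0<..<w i} t \<partial>lborel) \<partial>count_space I)"
    by (rule nn_integral_count_space_nn_integral[OF I]) auto
  also have "\<dots> = (\<integral>\<^sup>+i. ennreal (r i powr \<beta> * w i) \<partial>count_space I)"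
    using nonneg by (intro nn_integral_cong) (simp add: nn_integral_cmult_indicator ennreal_mult)
  finally show ?thesis .
qed

lemma choquet_integral_le_weighted_content:
  fixes \<Omega> :: "'a::metric_space set"
  assumes I: "ball_family I" and "0 \<le> M"
    and height: "\<And>x t. x \<in> \<Omega> \<Longrightarrow> 0 < t \<Longrightarrow> t < f x \<Longrightarrow> \<exists>(h, y, r)\<in>I. x \<in> ball y r \<and> t < M * (h * r powr \<kappa>) powr p"
  shows "choquet_integral (\<delta> - \<kappa> * p) \<Omega> f \<le> ennreal M * weighted_content p \<delta> I"
proof -
  define w where "w = (\<lambda>(h, y :: 'a, r). M * (h * r powr \<kappa>) powr p)"
  have "choquet_integral (\<delta> - \<kappa> * p) \<Omega> f
      \<le> (\<integral>\<^sup>+i. ennreal (snd (snd i) powr (\<delta> - \<kappa> * p) * w i) \<partial>count_space I)"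
  proof (rule choquet_integral_le_sum_of_heights)
    fix x t assume "x \<in> \<Omega>" "0 < t" "t < f x"
    from height[OF this] show "\<exists>i\<in>I. x \<in> ball (fst (snd i)) (snd (snd i)) \<and> t < w i"
      by (simp add: w_def case_prod_unfold)
  qed (use I \<open>0 \<le> M\<close> in \<open>auto simp: ball_family_def w_def\<close>)
  also have "\<dots> = (\<integral>\<^sup>+i. ennreal M * (case i of (h, y, r) \<Rightarrow> ennreal (h powr p * r powr \<delta>)) \<partial>count_space I)"
  proof (intro nn_integral_cong)
    fix i assume "i \<in> space (count_space I)"
    moreover obtain h y r where i: "i = (h, y, r)" by (cases i)
    ultimately have "0 < r" using I by (auto simp: ball_family_def)
    then have "snd (snd i) powr (\<delta> - \<kappa> * p) * w i = M * (h powr p * r powr \<delta>)"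
      by (simp add: i w_def powr_mult powr_powr powr_diff)
    then show "ennreal (snd (snd i) powr (\<delta> - \<kappa> * p) * w i)
        = ennreal M * (case i of (h, y, r) \<Rightarrow> ennreal (h powr p * r powr \<delta>))"
      using \<open>0 \<le> M\<close> by (simp only:) (simp add: i ennreal_mult)
  qed
  also have "\<dots> = ennreal M * weighted_content p \<delta> I"
    unfolding weighted_content_def by (rule nn_integral_cmult) simp
  finally show ?thesis .
qed

lemma choquet_integral_indicator_powr:
  "choquet_integral \<delta> UNIV (\<lambda>x. (indicator \<Omega> x * f x) powr p) = choquet_integral \<delta> \<Omega> (\<lambda>x. f x powr p)"
proof -
  have "{x. t < (indicator \<Omega> x * f x) powr p} = {x\<in>\<Omega>. t < f x powr p}" if "0 < t" for t
    using that by (auto simp: indicator_def split: if_splits)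
  then show ?thesis
    unfolding choquet_integral_def by (intro nn_integral_cong) (auto split: split_indicator)
qed

lemma enn_powr_le_ennreal:
  assumes "x \<le> ennreal c" "0 \<le> c" "0 \<le> a"
  shows "enn_powr x a \<le> ennreal (c powr a)"
proof -
  from assms obtain y where y: "x = ennreal y" "0 \<le> y" "y \<le> c"
    by (cases x) (auto simp: top_unique)
  then show ?thesis using assms by (auto simp: enn_powr_def intro!: ennreal_leI powr_mono2)
qed

lemma le_cmult_enn_powr:
  assumes "0 < c" "0 < a" and above: "\<And>G. F < ennreal G \<Longrightarrow> L \<le> ennreal (c * G powr a)"
  shows "L \<le> ennreal c * enn_powr F a"
proof (cases F)
  case top
  then show ?thesis using \<open>0 < c\<close> by (simp add: enn_powr_def ennreal_mult_top)
next
  case (real \<phi>)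
  have "(\<lambda>k. ennreal (c * (\<phi> + inverse (real (Suc k))) powr a)) \<longlonglongrightarrow> ennreal (c * (\<phi> + 0) powr a)"
    using \<open>0 < a\<close> real
    by (intro tendsto_ennrealI tendsto_mult tendsto_const tendsto_powr2 tendsto_add
        LIMSEQ_inverse_real_of_nat always_eventually) auto
  then have "L \<le> ennreal (c * (\<phi> + 0) powr a)"
  proof (rule LIMSEQ_le_const)
    show "\<exists>N. \<forall>k\<ge>N. L \<le> ennreal (c * (\<phi> + inverse (real (Suc k))) powr a)"
      using real by (intro exI allI impI above) (auto simp: ennreal_less_iff)
  qed
  also have "\<dots> = ennreal c * enn_powr F a"
    using real \<open>0 < c\<close> by (simp add: enn_powr_def ennreal_mult)
  finally show ?thesis .
qed

locale sobolev_exponents =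
  fixes \<delta> p \<kappa> a q :: real
  assumes \<delta>_pos: "0 < \<delta>" and p_pos: "0 < p" and \<kappa>_nonneg: "0 \<le> \<kappa>" and \<kappa>_less: "\<kappa> < a"
    and subcritical: "p * a < \<delta>" and q_eq: "q = (\<delta> - \<kappa> * p) * p / (\<delta> - p * a)"
begin

lemma q_pos: "0 < q"
proof -
  have "\<kappa> * p < a * p" using \<kappa>_less p_pos by (rule mult_strict_right_mono)
  then have "0 < \<delta> - \<kappa> * p" using subcritical by (simp add: mult.commute)
  then show ?thesis using p_pos subcritical by (simp add: q_eq)
qed

lemma interpolation_exponents:
  shows "(\<delta> / p - a) / ((a - \<kappa>) + (\<delta> / p - a)) = p / q"
    and "(a - \<kappa>) / ((a - \<kappa>) + (\<delta> / p - a)) = 1 - p / q"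
proof -
  have sum: "(a - \<kappa>) + (\<delta> / p - a) = (\<delta> - \<kappa> * p) / p" using p_pos by (simp add: field_simps)
  have "0 < (\<delta> - \<kappa> * p) * p / (\<delta> - p * a)" using q_pos by (simp add: q_eq)
  then have "0 < \<delta> - \<kappa> * p" using p_pos subcritical by (simp add: zero_less_divide_iff zero_less_mult_iff)
  then show first: "(\<delta> / p - a) / ((a - \<kappa>) + (\<delta> / p - a)) = p / q"
    unfolding sum q_eq using p_pos subcritical by (simp add: field_simps)
  then show "(a - \<kappa>) / ((a - \<kappa>) + (\<delta> / p - a)) = 1 - p / q"
    unfolding first[symmetric] using \<open>0 < \<delta> - \<kappa> * p\<close> p_pos by (simp add: sum field_simps)
qed

definition hedberg_const :: real where
  "hedberg_const = 2 / (1 - 2 powr - min (a - \<kappa>) (\<delta> / p - a))"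

lemma hedberg_exponents_pos: "0 < a - \<kappa>" "0 < \<delta> / p - a"
  using \<kappa>_less subcritical p_pos by (simp_all add: field_simps)

lemma hedberg_const_pos: "0 < hedberg_const"
  using hedberg_exponents_pos powr_less_one[of 2 "- min (a - \<kappa>) (\<delta> / p - a)"] by (simp add: hedberg_const_def)

lemma scaled_average_le_min:
  fixes f :: "'a::euclidean_space \<Rightarrow> real"
  assumes I: "ball_family I" "dominates_averages I f" and content: "weighted_content p \<delta> I \<le> ennreal W" "0 \<le> W"
    and heights: "\<And>h y t. (h, y, t) \<in> I \<Longrightarrow> x \<in> ball y t \<Longrightarrow> h * t powr \<kappa> \<le> N" and r: "0 < r"
  shows "ennreal (r powr (a - real DIM('a))) * ball_integral f x r
    \<le> ennreal (min (N * r powr (a - \<kappa>)) (W powr (1 / p) * r powr - (\<delta> / p - a)))"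
proof (cases "ball_integral f x r = 0")
  case False
  then obtain h y t where i: "(h, y, t) \<in> I" "x \<in> ball y t" "r \<le> t"
    and average: "ball_integral f x r \<le> ennreal (h * r ^ DIM('a))"
    using I(2) r unfolding dominates_averages_def by blast
  have h: "0 < h" using I(1) i(1) by (auto simp: ball_family_def)
  have "h * r powr \<kappa> \<le> h * t powr \<kappa>" using h r i(3) \<kappa>_nonneg by (intro mult_left_mono powr_mono2) auto
  also have "\<dots> \<le> N" by (rule heights[OF i(1,2)])
  finally have h_le_N: "h \<le> N * r powr - \<kappa>" using r by (simp add: powr_minus field_simps)
  have "h powr p * r powr \<delta> \<le> h powr p * t powr \<delta>"
    using r i(3) \<delta>_pos by (intro mult_left_mono powr_mono2) auto
  also have "\<dots> \<le> W"
    using order_trans[OF term_le_weighted_content[OF i(1)] content(1)] content(2)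
    by (subst (asm) ennreal_le_iff) auto
  finally have "(h powr p * r powr \<delta>) powr (1 / p) \<le> W powr (1 / p)"
    using p_pos by (intro powr_mono2) auto
  then have h_le_W: "h \<le> W powr (1 / p) * r powr - (\<delta> / p)"
    using h r p_pos by (simp add: powr_mult powr_powr powr_minus field_simps)
  have "ennreal (r powr (a - real DIM('a))) * ball_integral f x r
      \<le> ennreal (r powr (a - real DIM('a))) * ennreal (h * r ^ DIM('a))"
    by (intro mult_left_mono average) simp
  also have "\<dots> = ennreal (h * r powr a)"
    using h r by (simp add: ennreal_mult[symmetric] powr_diff powr_realpow)
  also have "\<dots> \<le> ennreal (min (N * r powr (a - \<kappa>)) (W powr (1 / p) * r powr - (\<delta> / p - a)))"
  proof (intro ennreal_leI min.boundedI)
    have "h * r powr a \<le> N * r powr - \<kappa> * r powr a" using h_le_N by (intro mult_right_mono) auto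
    then show "h * r powr a \<le> N * r powr (a - \<kappa>)" using r by (simp add: powr_diff powr_minus field_simps)
    have "h * r powr a \<le> W powr (1 / p) * r powr - (\<delta> / p) * r powr a" using h_le_W by (intro mult_right_mono) auto
    then show "h * r powr a \<le> W powr (1 / p) * r powr - (\<delta> / p - a)"
      using r by (simp add: powr_diff powr_minus field_simps)
  qed
  finally show ?thesis .
qed simp

lemma dyadic_riesz_potential_le:
  fixes f :: "'a::euclidean_space \<Rightarrow> real"
  assumes I: "ball_family I" "dominates_averages I f" and content: "weighted_content p \<delta> I \<le> ennreal W" "0 < W"
    and heights: "\<And>h y t. (h, y, t) \<in> I \<Longrightarrow> x \<in> ball y t \<Longrightarrow> h * t powr \<kappa> \<le> N" and "0 < N" "0 < R"
  shows "dyadic_riesz_potential a R f x \<le> ennreal (hedberg_const * (N powr (p / q) * W powr (1 / p - 1 / q)))"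
proof -
  have "dyadic_riesz_potential a R f x
      \<le> (\<Sum>j. ennreal (min (N * (R / 2 ^ j) powr (a - \<kappa>)) (W powr (1 / p) * (R / 2 ^ j) powr - (\<delta> / p - a))))"
    unfolding dyadic_riesz_potential_def using content(2) \<open>0 < R\<close>
    by (intro suminf_le scaled_average_le_min[OF I content(1) _ heights]) auto
  also have "\<dots> \<le> ennreal (hedberg_const * (N powr (p / q) * (W powr (1 / p)) powr (1 - p / q)))"
    using suminf_min_powr_le[OF hedberg_exponents_pos \<open>0 < R\<close> \<open>0 < N\<close>, of "W powr (1 / p)"] content(2)
    by (simp only: hedberg_const_def interpolation_exponents) simp
  also have "(W powr (1 / p)) powr (1 - p / q) = W powr (1 / p - 1 / q)"
    using p_pos q_pos by (simp add: powr_powr field_simps)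
  finally show ?thesis .
qed

lemma exists_high_ball:
  fixes f :: "'a::euclidean_space \<Rightarrow> real" and C W :: real
  defines "D \<equiv> C * hedberg_const * W powr (1 / p - 1 / q)"
  assumes I: "ball_family I" "dominates_averages I f" and content: "weighted_content p \<delta> I \<le> ennreal W" "0 < W"
    and pos: "0 < C" "0 < R"
    and potential: "ennreal \<bar>v\<bar> \<le> ennreal C * dyadic_riesz_potential a R f x"
    and t: "0 < t" "t < \<bar>v\<bar> powr q"
  shows "\<exists>(h, y, r)\<in>I. x \<in> ball y r \<and> t < D powr q * (h * r powr \<kappa>) powr p"
proof (rule ccontr)
  assume none: "\<not> ?thesis"
  have D: "0 < D" using pos hedberg_const_pos content by (simp add: D_def)
  define N where "N = (t / D powr q) powr (1 / p)"
  have N: "0 < N" using t D by (simp add: N_def)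
  have N_powr: "D powr q * N powr p = t" using t D p_pos by (simp add: N_def powr_powr)
  have "h * r powr \<kappa> \<le> N" if i: "(h, y, r) \<in> I" "x \<in> ball y r" for h y r
  proof (rule ccontr)
    assume "\<not> h * r powr \<kappa> \<le> N"
    then have "D powr q * N powr p < D powr q * (h * r powr \<kappa>) powr p"
      using N p_pos D by (intro mult_strict_left_mono powr_less_mono2) auto
    then show False using none i N_powr by auto
  qed
  from dyadic_riesz_potential_le[OF I content this N pos(2)]
  have "ennreal \<bar>v\<bar> \<le> ennreal C * ennreal (hedberg_const * (N powr (p / q) * W powr (1 / p - 1 / q)))"
    by (intro order_trans[OF potential] mult_left_mono) auto
  also have "\<dots> = ennreal (D * N powr (p / q))"
    using pos hedberg_const_pos by (simp add: ennreal_mult[symmetric] D_def mult_ac)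
  finally have "\<bar>v\<bar> \<le> D * N powr (p / q)" using D by (subst (asm) ennreal_le_iff) auto
  then have "\<bar>v\<bar> powr q \<le> (D * N powr (p / q)) powr q" using q_pos by (intro powr_mono2) auto
  also have "\<dots> = t" using q_pos N_powr by (simp add: powr_mult powr_powr)
  finally show False using t by simp
qed

lemma choquet_integral_powr_le:
  fixes f :: "'a::euclidean_space \<Rightarrow> real" and v :: "'a \<Rightarrow> real"
  assumes I: "ball_family I" "dominates_averages I f" and content: "weighted_content p \<delta> I \<le> ennreal W" "0 < W"
    and pos: "0 < C" "0 < R"
    and potential: "\<And>x. x \<in> \<Omega> \<Longrightarrow> ennreal \<bar>v x\<bar> \<le> ennreal C * dyadic_riesz_potential a R f x"
  shows "choquet_integral (\<delta> - \<kappa> * p) \<Omega> (\<lambda>x. \<bar>v x\<bar> powr q) \<le> ennreal ((C * hedberg_const * W powr (1 / p)) powr q)"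
proof -
  define D where "D = C * hedberg_const * W powr (1 / p - 1 / q)"
  have "choquet_integral (\<delta> - \<kappa> * p) \<Omega> (\<lambda>x. \<bar>v x\<bar> powr q) \<le> ennreal (D powr q) * weighted_content p \<delta> I"
    unfolding D_def
    by (intro choquet_integral_le_weighted_content[OF I(1)] exists_high_ball[OF I content pos potential]) simp
  also have "\<dots> \<le> ennreal (D powr q) * ennreal W" by (intro mult_left_mono content) simp
  also have "\<dots> = ennreal (D powr q * W)" using content(2) by (simp add: ennreal_mult)
  also have "D powr q = (C * hedberg_const) powr q * W powr (q / p - 1)"
    unfolding D_def powr_mult powr_powr using q_pos by (simp add: left_diff_distrib)
  then have "D powr q * W = (C * hedberg_const * W powr (1 / p)) powr q"
    using content(2) by (simp add: powr_mult powr_powr powr_diff)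
  finally show ?thesis .
qed

lemma obtain_sobolev_const:
  assumes dim: "\<delta> \<le> real DIM('a)" "\<delta> / real DIM('a) < p" and "0 < C" "0 < R"
  obtains c :: real where "0 < c"
    "\<And>(f :: 'a::euclidean_space \<Rightarrow> real) v \<Omega>. f \<in> borel_measurable borel \<Longrightarrow>
      (\<And>x. x \<in> \<Omega> \<Longrightarrow> ennreal \<bar>v x\<bar> \<le> ennreal C * dyadic_riesz_potential a R f x) \<Longrightarrow>
      enn_powr (choquet_integral (\<delta> - \<kappa> * p) \<Omega> (\<lambda>x. \<bar>v x\<bar> powr q)) (1 / q)
        \<le> ennreal c * enn_powr (choquet_integral \<delta> UNIV (\<lambda>x. f x powr p)) (1 / p)"
proof -
  obtain K :: real where K: "0 < K"
    and family: "\<And>(f :: 'a \<Rightarrow> real) G. f \<in> borel_measurable borel \<Longrightarrow>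
      choquet_integral \<delta> UNIV (\<lambda>x. f x powr p) < ennreal G \<Longrightarrow>
      \<exists>I. ball_family I \<and> dominates_averages I f \<and> weighted_content p \<delta> I \<le> ennreal (K * G)"
    using obtain_dominating_ball_family[OF \<delta>_pos dim] by blast
  define c where "c = C * hedberg_const * K powr (1 / p)"
  have c: "0 < c" using assms K hedberg_const_pos by (simp add: c_def)
  have "enn_powr (choquet_integral (\<delta> - \<kappa> * p) \<Omega> (\<lambda>x. \<bar>v x\<bar> powr q)) (1 / q)
      \<le> ennreal c * enn_powr (choquet_integral \<delta> UNIV (\<lambda>x. f x powr p)) (1 / p)"
    if f: "f \<in> borel_measurable borel"
      and potential: "\<And>x. x \<in> \<Omega> \<Longrightarrow> ennreal \<bar>v x\<bar> \<le> ennreal C * dyadic_riesz_potential a R f x"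
    for f :: "'a \<Rightarrow> real" and v \<Omega>
  proof (rule le_cmult_enn_powr[OF c])
    fix G assume less: "choquet_integral \<delta> UNIV (\<lambda>x. f x powr p) < ennreal G"
    have G: "0 < G" using le_less_trans[OF zero_le less] by simp
    obtain I where I: "ball_family I" "dominates_averages I f" "weighted_content p \<delta> I \<le> ennreal (K * G)"
      using family[OF f less] by blast
    have "choquet_integral (\<delta> - \<kappa> * p) \<Omega> (\<lambda>x. \<bar>v x\<bar> powr q)
        \<le> ennreal ((C * hedberg_const * (K * G) powr (1 / p)) powr q)"
      using K G assms by (intro choquet_integral_powr_le[OF I _ _ _ potential]) auto
    also have "C * hedberg_const * (K * G) powr (1 / p) = c * G powr (1 / p)"
      by (simp add: c_def powr_mult)
    finally have "enn_powr (choquet_integral (\<delta> - \<kappa> * p) \<Omega> (\<lambda>x. \<bar>v x\<bar> powr q)) (1 / q)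
        \<le> ennreal (((c * G powr (1 / p)) powr q) powr (1 / q))"
      using q_pos by (intro enn_powr_le_ennreal) auto
    then show "enn_powr (choquet_integral (\<delta> - \<kappa> * p) \<Omega> (\<lambda>x. \<bar>v x\<bar> powr q)) (1 / q) \<le> ennreal (c * G powr (1 / p))"
      using q_pos c by (simp add: powr_powr)
  qed (use p_pos in simp)
  with c show ?thesis using that by blast
qed

end

subsection \<open>The Poincare--Sobolev inequality\<close>

lemma sobolev_exponents_of_john:
  fixes n s \<delta> p \<kappa> q :: real
  assumes "2 \<le> n" "s < n / (n - 1)" "0 < \<delta>" "\<delta> / n < p" "p < \<delta> / (n + s * (1 - n))"
    and "0 \<le> \<kappa>" "\<kappa> < n + s * (1 - n)" "q = (\<delta> - \<kappa> * p) * p / (\<delta> - p * (n + s * (1 - n)))"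
  shows "sobolev_exponents \<delta> p \<kappa> (n + s * (1 - n)) q"
proof
  have "0 < \<delta> / n" using assms by simp
  then show "0 < p" using assms by linarith
  have "s * (n - 1) < n" using assms by (simp add: pos_less_divide_eq)
  then have "0 < n + s * (1 - n)" by (simp add: algebra_simps)
  then show "p * (n + s * (1 - n)) < \<delta>" using assms by (simp add: pos_less_divide_eq)
qed (use assms in auto)

theorem theorem4p7:
  fixes \<Omega> :: "'a::euclidean_space set"
    and s \<delta> p \<kappa> q :: real
  defines "n \<equiv> real DIM('a)"
  assumes "DIM('a) \<ge> 2"
    and "s_john_domain s \<Omega>"
    and "1 \<le> s" and "s < n / (n - 1)"
    and "0 < \<delta>" and "\<delta> \<le> n"
    and "\<delta> / n < p" and "p < \<delta> / (n + s * (1 - n))"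
    and "0 \<le> \<kappa>" and "\<kappa> < n + s * (1 - n)"
    and "q = (\<delta> - \<kappa> * p) * p / (\<delta> - p * (n + s * (1 - n)))"
  shows "\<exists>c::real. 0 < c \<and>
    (\<forall>(u::'a \<Rightarrow> real) (g::'a \<Rightarrow> 'a).
       (\<forall>x\<in>\<Omega>. (u has_derivative (\<lambda>h. g x \<bullet> h)) (at x)) \<and> continuous_on \<Omega> g \<longrightarrow>
       (INF b::real. enn_powr (choquet_integral (\<delta> - \<kappa> * p) \<Omega> (\<lambda>x. \<bar>u x - b\<bar> powr q)) (1 / q))
         \<le> ennreal c * enn_powr (choquet_integral \<delta> \<Omega> (\<lambda>x. norm (g x) powr p)) (1 / p))"
proof -
  interpret sobolev_exponents \<delta> p \<kappa> "n + s * (1 - n)" q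
    using assms by (intro sobolev_exponents_of_john) (auto simp: n_def)
  let ?I = "dyadic_riesz_potential (n + s * (1 - n))"
  obtain C R :: real where C: "0 < C" and R: "0 < R" and john: "\<And>u g. C1_gradient \<Omega> u g \<Longrightarrow>
      \<exists>b. \<forall>x\<in>\<Omega>. ennreal \<bar>u x - b\<bar> \<le> ennreal C * ?I R (C1_gradient.grad_norm \<Omega> g) x"
    using s_john_domain_pointwise_estimate[OF assms(3), folded n_def] by blast
  obtain c :: real where "0 < c" and sobolev: "\<And>(f :: 'a \<Rightarrow> real) v \<Omega>. f \<in> borel_measurable borel \<Longrightarrow>
      (\<And>x. x \<in> \<Omega> \<Longrightarrow> ennreal \<bar>v x\<bar> \<le> ennreal C * ?I R f x) \<Longrightarrow>
      enn_powr (choquet_integral (\<delta> - \<kappa> * p) \<Omega> (\<lambda>x. \<bar>v x\<bar> powr q)) (1 / q)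
        \<le> ennreal c * enn_powr (choquet_integral \<delta> UNIV (\<lambda>x. f x powr p)) (1 / p)"
    using obtain_sobolev_const[OF _ _ C R, where 'a = 'a, folded n_def, OF assms(7,8)] by blast
  show ?thesis
  proof (intro exI conjI allI impI)
    fix u :: "'a \<Rightarrow> real" and g :: "'a \<Rightarrow> 'a"
    assume "(\<forall>x\<in>\<Omega>. (u has_derivative (\<lambda>h. g x \<bullet> h)) (at x)) \<and> continuous_on \<Omega> g"
    then interpret C1_gradient \<Omega> u g using assms(3) by unfold_locales (auto simp: s_john_domain_def)
    obtain b where "\<And>x. x \<in> \<Omega> \<Longrightarrow> ennreal \<bar>u x - b\<bar> \<le> ennreal C * ?I R grad_norm x"
      using john[OF C1_gradient_axioms] by blast
    from sobolev[OF borel_measurable_grad_norm this]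
    show "(INF b. enn_powr (choquet_integral (\<delta> - \<kappa> * p) \<Omega> (\<lambda>x. \<bar>u x - b\<bar> powr q)) (1 / q))
        \<le> ennreal c * enn_powr (choquet_integral \<delta> \<Omega> (\<lambda>x. norm (g x) powr p)) (1 / p)"
      unfolding grad_norm_def choquet_integral_indicator_powr by (rule INF_lower2[OF UNIV_I])
  qed fact
qed

end
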